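(* Let $k\ge3$ be fixed, let $K_k$ be the $k$-clique, let $\delta>0$, and let $p=p(n)\in(0,1)$. If $n^{1/(k-1)}p\to\infty$ and $p\to0$, then \[\lim_{n\to\infty}\frac{\phi_{K_k}(n,p,\delta)}{n^2p^{k-1}\log(1/p)}=\min\Big\{\tfrac12\delta^{2/k},\ \delta/k\Big\}.\] If $n^{2/(k-1)}p\to\infty$ and $n^{1/(k-1)}p\to0$, then \[\lim_{n\to\infty}\frac{\phi_{K_k}(n,p,\delta)}{n^2p^{k-1}\log(1/p)}=\tfrac12\delta^{2/k}.\]
   Context: For $0<p<1$ and $x\in[0,1]$ let $I_p(x)=x\log\frac{x}{p}+(1-x)\log\frac{1-x}{1-p}$ (with $0\log0=0$). Let $\mathscr{G}_n$ be the set of weighted graphs $G=(g_{ij})$ on $n$ vertices with $0\le g_{ij}\le1$, $g_{ij}=g_{ji}$, $g_{ii}=0$, and $I_p(G)=\sum_{i<j}I_p(g_{ij})$. For a graph $H$ on vertex set $\{1,\dots,k\}$, $t(H,G)=n^{-k}\sum_{1\le x_1,\dots,x_k\le n}\prod_{ij\in E(H)}g_{x_ix_j}$, and $\phi_H(n,p,\delta)=\inf\{I_p(G):G\in\mathscr{G}_n,\ t(H,G)\ge(1+\delta)p^{|E(H)|}\}$. *)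

theory Defs
  imports "HOL-Analysis.Analysis" "HOL-Library.Extended_Real"
begin

text \<open>The convention \<open>0 log 0 = 0\<close> holds automatically, the factor in front of \<open>ln\<close> being \<open>0\<close>.\<close>

definition rel_entropy :: "real \<Rightarrow> real \<Rightarrow> real" where
  "rel_entropy p x = x * ln (x / p) + (1 - x) * ln ((1 - x) / (1 - p))"

text \<open>Values of \<open>G\<close> outside \<open>{1..n} \<times> {1..n}\<close> are unconstrained; none of the notions below
  depends on them.\<close>

definition weighted_graphs :: "nat \<Rightarrow> (nat \<Rightarrow> nat \<Rightarrow> real) set" where
  "weighted_graphs n = {G. \<forall>i\<in>{1..n}. \<forall>j\<in>{1..n}.
     0 \<le> G i j \<and> G i j \<le> 1 \<and> G i j = G j i \<and> G i i = 0}"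

definition graph_entropy :: "nat \<Rightarrow> real \<Rightarrow> (nat \<Rightarrow> nat \<Rightarrow> real) \<Rightarrow> real" where
  "graph_entropy n p G = (\<Sum>(i, j)\<in>{(i, j). 1 \<le> i \<and> i < j \<and> j \<le> n}. rel_entropy p (G i j))"

text \<open>A simple graph on the vertex set \<open>{1..k}\<close> is given by its edge set \<open>E\<close>, in which every
  edge occurs exactly once, as the pair \<open>(i, j)\<close> with \<open>1 \<le> i < j \<le> k\<close>. So \<open>card E\<close> is its
  number of edges.\<close>

definition clique_edges :: "nat \<Rightarrow> (nat \<times> nat) set" where
  "clique_edges k = {(i, j). 1 \<le> i \<and> i < j \<and> j \<le> k}"

definition hom_density ::
  "nat \<Rightarrow> (nat \<times> nat) set \<Rightarrow> nat \<Rightarrow> (nat \<Rightarrow> nat \<Rightarrow> real) \<Rightarrow> real" where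
  "hom_density k E n G =
     (\<Sum>x\<in>{1..k} \<rightarrow>\<^sub>E {1..n}. \<Prod>(i, j)\<in>E. G (x i) (x j)) / real n ^ k"

text \<open>The infimum is taken in the extended reals, so that it is \<open>\<infinity>\<close> if no graph is admissible.\<close>

definition phi :: "nat \<Rightarrow> (nat \<times> nat) set \<Rightarrow> nat \<Rightarrow> real \<Rightarrow> real \<Rightarrow> ereal" where
  "phi k E n p \<delta> =
     (INF G\<in>{G \<in> weighted_graphs n. hom_density k E n G \<ge> (1 + \<delta>) * p ^ card E}.
        ereal (graph_entropy n p G))"

end

theory Submission
  imports Defs "HOL-Real_Asymp.Real_Asymp"
begin

text \<open>
  Write \<open>N = k - 1\<close>, \<open>L = ln (1 / p)\<close> and let \<open>U\<close> be the positive part of \<open>G - p\<close>. The Gibbs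
  variational inequality bounds the entropy of \<open>G\<close> from below by about \<open>L/2\<close> times the sum of
  \<open>U\<^sup>2\<close>. It also shows that, for a small constant \<open>b\<close>, only \<open>O(n p\<^sup>N)\<close> vertices (the hubs) have
  \<open>U\<close>-degree at least \<open>b n\<close>, and that the degrees \<open>d\<close> of the other vertices, divided by \<open>n\<close>,
  have mean square \<open>O(b p\<^sup>N)\<close>.

  In the clique density of \<open>p + U\<close>, the tuples with a vertex mapped to a hub contribute
  \<open>k \<theta>\<close> times the density \<open>p\<^sup>e\<close> of the constant graph (\<open>e\<close> is the number of edges of the
  clique), where \<open>\<theta> p\<^sup>N\<close> is the normalised sum of \<open>U\<^sup>2\<close> over the edges
  from hubs. The tuples avoiding hubs are expanded over the subgraphs \<open>F\<close> of the clique: the empty one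
  gives \<open>p\<^sup>e\<close>, the full one gives at most \<open>\<phi>\<^bsup>k/2\<^esup> p\<^sup>e\<close> by Finner's inequality, where \<open>\<phi> p\<^sup>N\<close> is
  the normalised sum of \<open>U\<^sup>2\<close> away from the hubs, and every other \<open>F\<close> is negligible, since it has
  a vertex \<open>a\<close> with a neighbour \<open>v\<close> and a non-neighbour, so that Hoelder's inequality in the variable
  of \<open>a\<close> has slack, which turns the factor of the edge \<open>av\<close> into the small mean square
  degree. Hence \<open>\<delta> \<le> \<phi>\<^bsup>k/2\<^esup> + k \<theta> + o(1)\<close>, while the entropy is at least
  \<open>(\<phi>/2 + \<theta> - o(1)) n\<^sup>2 p\<^sup>N L\<close>; minimising gives the lower bound. If \<open>n p\<^sup>N \<rightarrow> 0\<close> then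
  there are no hubs at all and \<open>\<theta> = 0\<close>. The upper bounds come from planting a clique on about
  \<open>\<delta>\<^bsup>1/k\<^esup> p\<^bsup>N/2\<^esup> n\<close> vertices or a hub on about \<open>(\<delta>/k) p\<^sup>N n\<close> vertices.
\<close>

section \<open>Averages, Hoelder's and Finner's inequalities\<close>

text \<open>Total mass 1 is what lets Hoelder's and Finner's inequalities below hold for exponents
  of total less than 1.\<close>

definition avg :: "'a set \<Rightarrow> ('a \<Rightarrow> real) \<Rightarrow> real" where
  "avg A f = sum f A / real (card A)"

lemma avg_mono: "(\<And>x. x \<in> A \<Longrightarrow> f x \<le> g x) \<Longrightarrow> avg A f \<le> avg A g"
  by (auto simp: avg_def intro!: divide_right_mono sum_mono)

lemma avg_cong: "(\<And>x. x \<in> A \<Longrightarrow> f x = g x) \<Longrightarrow> avg A f = avg A g"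
  by (simp add: avg_def)

lemma avg_nonneg: "(\<And>x. x \<in> A \<Longrightarrow> 0 \<le> f x) \<Longrightarrow> 0 \<le> avg A f"
  by (auto simp: avg_def intro!: divide_nonneg_nonneg sum_nonneg)

lemma avg_const: "finite A \<Longrightarrow> A \<noteq> {} \<Longrightarrow> avg A (\<lambda>x. c) = c"
  by (simp add: avg_def)

lemma avg_add: "avg A (\<lambda>x. f x + g x) = avg A f + avg A g"
  by (simp add: avg_def sum.distrib add_divide_distrib)

lemma avg_diff: "avg A (\<lambda>x. f x - g x) = avg A f - avg A g"
  by (simp add: avg_def sum_subtractf diff_divide_distrib)

lemma avg_mult_left: "avg A (\<lambda>x. c * f x) = c * avg A f"
  by (simp add: avg_def sum_distrib_left)

lemma avg_mult_right: "avg A (\<lambda>x. f x * c) = avg A f * c"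
  by (simp add: avg_def sum_distrib_right)

lemma avg_divide: "avg A (\<lambda>x. f x / c) = avg A f / c"
  by (simp add: avg_def sum_divide_distrib mult.commute)

lemma avg_sum: "avg A (\<lambda>x. \<Sum>i\<in>I. f i x) = (\<Sum>i\<in>I. avg A (f i))"
  unfolding avg_def by (subst sum.swap) (simp add: sum_divide_distrib)

lemma avg_swap: "avg A (\<lambda>x. avg B (f x)) = avg B (\<lambda>y. avg A (\<lambda>x. f x y))"
  unfolding avg_def sum_divide_distrib[symmetric] by (subst sum.swap) (simp add: mult.commute)

lemma avg_le_const:
  assumes "finite A" "A \<noteq> {}" "\<And>x. x \<in> A \<Longrightarrow> f x \<le> c"
  shows "avg A f \<le> c"
  using avg_mono[of A f "\<lambda>_. c"] assms by (simp add: avg_const)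

lemma avg_eq_0_imp:
  assumes "finite A" "A \<noteq> {}" "\<And>x. x \<in> A \<Longrightarrow> 0 \<le> f x" "avg A f = 0" "x \<in> A"
  shows "f x = 0"
proof -
  have "sum f A = 0" using assms by (simp add: avg_def)
  then show ?thesis using assms by (simp add: sum_nonneg_eq_0_iff)
qed

text \<open>The variance of \<open>f\<close> is nonnegative.\<close>

lemma avg_square_le:
  assumes "finite A" "A \<noteq> {}"
  shows "(avg A f)\<^sup>2 \<le> avg A (\<lambda>x. (f x)\<^sup>2)"
proof -
  have "0 \<le> avg A (\<lambda>x. (f x - avg A f)\<^sup>2)" by (intro avg_nonneg) simp
  also have "\<dots> = avg A (\<lambda>x. (f x)\<^sup>2 - (2 * avg A f) * f x + (avg A f)\<^sup>2)"
    by (simp add: power2_diff algebra_simps)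
  also have "\<dots> = avg A (\<lambda>x. (f x)\<^sup>2) - (avg A f)\<^sup>2"
    using assms by (simp only: avg_add avg_diff avg_mult_left avg_const[OF assms]) (simp add: power2_eq_square)
  finally show ?thesis by simp
qed

section \<open>Averages over product spaces, one coordinate at a time\<close>

lemma avg_PiE_insert:
  assumes "finite I" "a \<notin> I"
  shows "avg (PiE (insert a I) (\<lambda>_. V)) f
       = avg (PiE I (\<lambda>_. V)) (\<lambda>x. avg V (\<lambda>y. f (x(a := y))))"
proof -
  have "sum f (PiE (insert a I) (\<lambda>_. V))
      = (\<Sum>(y, x)\<in>V \<times> PiE I (\<lambda>_. V). f (x(a := y)))"
    unfolding PiE_insert_eq
    by (subst sum.reindex[OF inj_combinator[OF assms(2)]]) (simp add: case_prod_unfold o_def)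
  also have "\<dots> = (\<Sum>x\<in>PiE I (\<lambda>_. V). \<Sum>y\<in>V. f (x(a := y)))"
    by (subst sum.swap) (simp add: sum.cartesian_product)
  finally show ?thesis
    using assms by (simp add: avg_def card_funcsetE sum_divide_distrib mult.commute)
qed

lemma avg_PiE_empty: "avg (PiE {} (\<lambda>_. V)) f = f (\<lambda>_. undefined)"
  by (simp add: avg_def)

lemma finite_funcset: "finite I \<Longrightarrow> finite V \<Longrightarrow> finite (PiE I (\<lambda>_. V))"
  by (rule finite_PiE) auto

lemma avg_PiE_one:
  assumes "finite I" "finite V" "V \<noteq> {}" "i \<in> I"
  shows "avg (PiE I (\<lambda>_. V)) (\<lambda>x. g (x i)) = avg V g"
proof -
  have "avg (PiE (insert i (I - {i})) (\<lambda>_. V)) (\<lambda>x. g (x i)) = avg V g"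
    using assms by (subst avg_PiE_insert) (auto simp: avg_const finite_funcset PiE_eq_empty_iff)
  then show ?thesis using assms by (simp add: insert_absorb)
qed

lemma avg_PiE_two:
  assumes "finite I" "finite V" "V \<noteq> {}" "i \<in> I" "j \<in> I" "i \<noteq> j"
  shows "avg (PiE I (\<lambda>_. V)) (\<lambda>x. g (x i) (x j)) = avg V (\<lambda>u. avg V (\<lambda>v. g u v))"
proof -
  have "avg (PiE (insert j (I - {j})) (\<lambda>_. V)) (\<lambda>x. g (x i) (x j))
      = avg (PiE (I - {j}) (\<lambda>_. V)) (\<lambda>x. avg V (\<lambda>y. g (x i) y))"
    using assms by (subst avg_PiE_insert) auto
  also have "\<dots> = avg V (\<lambda>u. avg V (\<lambda>v. g u v))"
    using assms by (subst avg_PiE_one) auto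
  finally show ?thesis using assms by (simp add: insert_absorb)
qed

section \<open>Weighted AM-GM, Hoelder and Finner\<close>

lemma weighted_am_gm:
  fixes a w :: "'e \<Rightarrow> real"
  assumes "finite E" "\<And>e. e \<in> E \<Longrightarrow> 0 \<le> a e" "\<And>e. e \<in> E \<Longrightarrow> 0 < w e" "sum w E \<le> 1"
  shows "(\<Prod>e\<in>E. a e powr w e) \<le> (\<Sum>e\<in>E. w e * a e) + (1 - sum w E)"
proof (cases "\<exists>e\<in>E. a e = 0")
  case True
  then have "(\<Prod>e\<in>E. a e powr w e) = 0" using assms by (intro prod_zero) auto
  moreover have "0 \<le> (\<Sum>e\<in>E. w e * a e)"
    using assms(2,3) by (intro sum_nonneg mult_nonneg_nonneg) (auto intro: less_imp_le)
  ultimately show ?thesis using assms(4) by linarith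
next
  case False
  then have pos: "\<And>e. e \<in> E \<Longrightarrow> 0 < a e" using assms by (simp add: order_less_le)
  define c where "c = 1 - sum w E"
  \<comment> \<open>\<open>T\<close> is the right-hand side to be reached; \<open>c\<close> acts as
    the weight of an extra factor 1. The tangent of \<open>ln\<close> at \<open>T\<close> bounds
    each \<open>ln (a e)\<close> and also \<open>ln 1\<close>, and the weighted sum of these bounds
    is \<open>ln T\<close>.\<close>
  define T where "T = (\<Sum>e\<in>E. w e * a e) + c"
  have T: "T > 0"
  proof (cases "E = {}")
    case False
    then have "(\<Sum>e\<in>E. w e * a e) > 0" using assms pos by (intro sum_pos) auto
    then show ?thesis using assms by (simp add: T_def c_def)
  qed (simp add: T_def c_def)
  have c: "c \<ge> 0" using assms by (simp add: c_def)
  have "(\<Sum>e\<in>E. w e * ln (a e)) \<le> (\<Sum>e\<in>E. w e * (ln T + a e / T - 1))"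
  proof (intro sum_mono mult_left_mono)
    fix e assume e: "e \<in> E"
    have "ln (a e / T) \<le> a e / T - 1" using pos[OF e] T by (intro ln_le_minus_one) auto
    then show "ln (a e) \<le> ln T + a e / T - 1" using pos[OF e] T by (simp add: ln_div)
  qed (use assms in \<open>auto intro: less_imp_le\<close>)
  also have "\<dots> = (1 - c) * (ln T - 1) + (T - c) / T"
  proof -
    have "(\<Sum>e\<in>E. w e * (ln T + a e / T - 1)) = (\<Sum>e\<in>E. w e * (ln T - 1) + (w e * a e) / T)"
      by (intro sum.cong refl) (simp add: algebra_simps)
    also have "\<dots> = (1 - c) * (ln T - 1) + (T - c) / T"
      by (simp add: sum.distrib sum_distrib_right[symmetric] sum_divide_distrib[symmetric] c_def T_def)
    finally show ?thesis .
  qed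
  also have "\<dots> = ln T + c * (- ln T - 1 / T + 1)" using T by (simp add: field_simps)
  also have "\<dots> \<le> ln T"
  proof -
    have "ln (1 / T) \<le> 1 / T - 1" using T by (intro ln_le_minus_one) auto
    then have "- ln T - 1 / T + 1 \<le> 0" using T by (simp add: ln_div)
    then show ?thesis using c by (simp add: mult_nonneg_nonpos)
  qed
  finally have "exp (\<Sum>e\<in>E. w e * ln (a e)) \<le> T" using T by (metis exp_le_cancel_iff exp_ln)
  moreover have "(\<Prod>e\<in>E. a e powr w e) = exp (\<Sum>e\<in>E. w e * ln (a e))"
    using assms(1) by (subst exp_sum) (auto intro!: prod.cong simp: powr_def dest: pos)
  ultimately show ?thesis by (simp add: T_def c_def)
qed

text \<open>Each \<open>f e\<close> is divided by its mean; then weighted AM-GM applies pointwise,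
  and its right side has average \<open>sum w E + (1 - sum w E) = 1\<close>. A factor of mean 0
  vanishes on \<open>V\<close>, which makes the left side 0.\<close>

lemma hoelder_avg:
  fixes f :: "'e \<Rightarrow> 'a \<Rightarrow> real"
  assumes V: "finite V" "V \<noteq> {}" and E: "finite E"
    and f: "\<And>e y. e \<in> E \<Longrightarrow> y \<in> V \<Longrightarrow> 0 \<le> f e y"
    and w: "\<And>e. e \<in> E \<Longrightarrow> 0 < w e" "sum w E \<le> 1"
  shows "avg V (\<lambda>y. \<Prod>e\<in>E. f e y powr w e) \<le> (\<Prod>e\<in>E. avg V (f e) powr w e)"
proof (cases "\<exists>e\<in>E. avg V (f e) = 0")
  case True
  then obtain e where e: "e \<in> E" "avg V (f e) = 0" by auto
  then have "f e y = 0" if "y \<in> V" for y using avg_eq_0_imp[of V "f e" y] V f that by auto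
  then have "avg V (\<lambda>y. \<Prod>e\<in>E. f e y powr w e) = avg V (\<lambda>y. 0)"
    using E e by (intro avg_cong prod_zero) (auto intro!: bexI[of _ e])
  then show ?thesis using V by (simp add: avg_const prod_nonneg)
next
  case False
  define m where "m e = avg V (f e)" for e
  have m: "m e > 0" if "e \<in> E" for e
    using False that avg_nonneg[of V "f e"] f by (auto simp: m_def order_less_le)
  have "avg V (\<lambda>y. \<Prod>e\<in>E. f e y powr w e)
      = avg V (\<lambda>y. (\<Prod>e\<in>E. m e powr w e) * (\<Prod>e\<in>E. (f e y / m e) powr w e))"
  proof (intro avg_cong)
    fix y assume "y \<in> V"
    then show "(\<Prod>e\<in>E. f e y powr w e) = (\<Prod>e\<in>E. m e powr w e) * (\<Prod>e\<in>E. (f e y / m e) powr w e)"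
      unfolding prod.distrib[symmetric]
      by (intro prod.cong refl) (use f m in \<open>force simp: powr_mult[symmetric] less_imp_le\<close>)
  qed
  also have "\<dots> \<le> (\<Prod>e\<in>E. m e powr w e) * avg V (\<lambda>y. (\<Sum>e\<in>E. w e * (f e y / m e)) + (1 - sum w E))"
    unfolding avg_mult_left using f m w E
    by (intro mult_left_mono avg_mono weighted_am_gm prod_nonneg) (auto simp: less_imp_le)
  also have "avg V (\<lambda>y. (\<Sum>e\<in>E. w e * (f e y / m e)) + (1 - sum w E))
      = (\<Sum>e\<in>E. w e * (m e / m e)) + (1 - sum w E)"
    using V by (simp only: avg_add avg_sum avg_mult_left avg_divide avg_const[OF V] m_def)
  also have "(\<Sum>e\<in>E. w e * (m e / m e)) = sum w E"
    by (intro sum.cong refl) (use m in force)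
  finally show ?thesis by (simp add: m_def)
qed

text \<open>The variables are averaged out one by one. Only factors with \<open>a \<in> S e\<close>
  see the variable of \<open>a\<close>, and their exponents sum to at most 1, so Hoelder's
  inequality moves the average inside each of them.\<close>

lemma finner_avg:
  fixes f :: "'e \<Rightarrow> ('i \<Rightarrow> 'a) \<Rightarrow> real"
  assumes "finite I" and V: "finite V" "V \<noteq> {}" and E: "finite E"
    and "\<And>e x. e \<in> E \<Longrightarrow> 0 \<le> f e x"
    and "\<And>e x y. e \<in> E \<Longrightarrow> (\<And>i. i \<in> S e \<Longrightarrow> x i = y i) \<Longrightarrow> f e x = f e y"
    and w: "\<And>e. e \<in> E \<Longrightarrow> 0 < w e"
    and "\<And>i. i \<in> I \<Longrightarrow> (\<Sum>e\<in>{e \<in> E. i \<in> S e}. w e) \<le> 1"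
  shows "avg (PiE I (\<lambda>_. V)) (\<lambda>x. \<Prod>e\<in>E. f e x powr w e)
      \<le> (\<Prod>e\<in>E. avg (PiE I (\<lambda>_. V)) (f e) powr w e)"
  using assms(1,5,6,8)
proof (induction I arbitrary: f rule: finite_induct)
  case empty
  show ?case by (simp only: avg_PiE_empty order_refl)
next
  case (insert a I)
  \<comment> \<open>If \<open>a \<notin> S e\<close>, averaging changes nothing, so the same formula
    serves all factors and the induction hypothesis applies to the whole family
    \<open>g\<close>.\<close>
  define g where "g e x = avg V (\<lambda>y. f e (x(a := y)))" for e x
  let ?Ea = "{e \<in> E. a \<in> S e}"
  let ?Eb = "{e \<in> E. a \<notin> S e}"
  have split: "(\<Prod>e\<in>E. h e) = (\<Prod>e\<in>?Ea. h e) * (\<Prod>e\<in>?Eb. h e)" for h :: "'e \<Rightarrow> real"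
    using E by (subst prod.union_disjoint[symmetric]) (auto intro!: prod.cong)
  have const: "f e (x(a := y)) = f e x" if "e \<in> ?Eb" for e x y
    using that by (intro insert.prems(2)) auto
  have "avg (PiE (insert a I) (\<lambda>_. V)) (\<lambda>x. \<Prod>e\<in>E. f e x powr w e)
      = avg (PiE I (\<lambda>_. V)) (\<lambda>x. avg V (\<lambda>y. \<Prod>e\<in>E. f e (x(a := y)) powr w e))"
    using insert.hyps by (simp add: avg_PiE_insert)
  also have "\<dots> \<le> avg (PiE I (\<lambda>_. V)) (\<lambda>x. \<Prod>e\<in>E. g e x powr w e)"
  proof (intro avg_mono)
    fix x
    have "avg V (\<lambda>y. \<Prod>e\<in>E. f e (x(a := y)) powr w e)
        = avg V (\<lambda>y. (\<Prod>e\<in>?Ea. f e (x(a := y)) powr w e)) * (\<Prod>e\<in>?Eb. f e x powr w e)"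
      by (simp add: split const avg_mult_right)
    also have "\<dots> \<le> (\<Prod>e\<in>?Ea. avg V (\<lambda>y. f e (x(a := y))) powr w e) * (\<Prod>e\<in>?Eb. f e x powr w e)"
      using V E w insert.prems(1) insert.prems(3)[of a]
      by (intro mult_right_mono hoelder_avg[where f = "\<lambda>e y. f e (x(a := y))"] prod_nonneg) auto
    also have "\<dots> = (\<Prod>e\<in>E. g e x powr w e)"
      using V by (simp add: split g_def const avg_const)
    finally show "avg V (\<lambda>y. \<Prod>e\<in>E. f e (x(a := y)) powr w e) \<le> (\<Prod>e\<in>E. g e x powr w e)" .
  qed
  also have "\<dots> \<le> (\<Prod>e\<in>E. avg (PiE I (\<lambda>_. V)) (g e) powr w e)"
  proof (rule insert.IH)
    show "g e x = g e y" if "e \<in> E" "\<And>i. i \<in> S e \<Longrightarrow> x i = y i" for e x y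
      unfolding g_def using that by (intro avg_cong insert.prems(2)) auto
  qed (use insert.prems(1,3) in \<open>auto simp: g_def intro: avg_nonneg\<close>)
  also have "\<dots> = (\<Prod>e\<in>E. avg (PiE (insert a I) (\<lambda>_. V)) (f e) powr w e)"
    using insert.hyps by (simp add: avg_PiE_insert g_def[abs_def])
  finally show ?case .
qed

section \<open>Weighted clique densities\<close>

text \<open>The clique on an arbitrary vertex set, so that single vertices can be split off; it
  specialises to \<open>clique_edges\<close>.\<close>

definition edges :: "nat set \<Rightarrow> (nat \<times> nat) set" where
  "edges I = {(i, j). i \<in> I \<and> j \<in> I \<and> i < j}"

lemma finite_edges [simp]: "finite I \<Longrightarrow> finite (edges I)"
  by (rule finite_subset[of _ "I \<times> I"]) (auto simp: edges_def)

lemma edges_insert: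
  assumes "a \<notin> I"
  shows "edges (insert a I) = edges I \<union> (\<lambda>j. (min a j, max a j)) ` I" (is "?L = ?R")
proof
  show "?L \<subseteq> ?R"
  proof
    fix e assume "e \<in> ?L"
    then obtain i j where e: "e = (i, j)" "i \<in> insert a I" "j \<in> insert a I" "i < j"
      by (auto simp: edges_def)
    show "e \<in> ?R"
    proof (cases "i = a \<or> j = a")
      case True
      then have "e = (min a (if i = a then j else i), max a (if i = a then j else i))"
        "(if i = a then j else i) \<in> I" using e by (auto simp: min_def max_def)
      then show ?thesis by blast
    qed (use e in \<open>auto simp: edges_def\<close>)
  qed
  show "?R \<subseteq> ?L"
    using assms by (auto simp: edges_def min_def max_def le_less split: if_splits)
qed

lemma inj_on_min_max: "inj_on (\<lambda>j. (min a j, max a j)) (I :: nat set)"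
  by (auto simp: inj_on_def min_def max_def split: if_splits)

lemma edges_disjoint:
  assumes "a \<notin> I"
  shows "edges I \<inter> (\<lambda>j. (min a j, max a j)) ` I = {}"
  using assms by (auto simp: edges_def min_def max_def split: if_splits)

lemma prod_edges_insert:
  fixes f :: "nat \<Rightarrow> nat \<Rightarrow> real"
  assumes "finite I" "a \<notin> I" "\<And>j. j \<in> I \<Longrightarrow> f j a = f a j"
  shows "(\<Prod>(i, j)\<in>edges (insert a I). f i j) = (\<Prod>(i, j)\<in>edges I. f i j) * (\<Prod>j\<in>I. f a j)"
proof -
  have "(\<Prod>(i, j)\<in>(\<lambda>j. (min a j, max a j)) ` I. f i j) = (\<Prod>j\<in>I. f (min a j) (max a j))"
    by (simp add: prod.reindex[OF inj_on_min_max])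
  also have "\<dots> = (\<Prod>j\<in>I. f a j)"
    by (intro prod.cong refl) (auto simp: min_def max_def assms(3))
  finally show ?thesis
    using assms(1,2) by (simp add: edges_insert prod.union_disjoint edges_disjoint)
qed

lemma card_edges_insert:
  "finite I \<Longrightarrow> a \<notin> I \<Longrightarrow> card (edges (insert a I)) = card (edges I) + card I"
  by (simp add: edges_insert card_Un_disjoint edges_disjoint card_image inj_on_min_max)

lemma card_edges: "finite I \<Longrightarrow> 2 * card (edges I) = card I * (card I - 1)"
proof (induction I rule: finite_induct)
  case (insert a I)
  then show ?case by (cases "card I") (simp_all add: card_edges_insert algebra_simps)
qed (simp add: edges_def)

lemma edges_degree:
  assumes "finite I" "i \<in> I"
  shows "card {e \<in> edges I. i \<in> {fst e, snd e}} \<le> card I - 1"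
proof -
  have "{e \<in> edges I. i \<in> {fst e, snd e}} \<subseteq> (\<lambda>j. (min i j, max i j)) ` (I - {i})"
  proof
    fix e assume "e \<in> {e \<in> edges I. i \<in> {fst e, snd e}}"
    then obtain a b where e: "e = (a, b)" "a \<in> I" "b \<in> I" "a < b" "i = a \<or> i = b"
      by (auto simp: edges_def)
    then have "e = (min i (if i = a then b else a), max i (if i = a then b else a))"
      "(if i = a then b else a) \<in> I - {i}" by auto
    then show "e \<in> (\<lambda>j. (min i j, max i j)) ` (I - {i})" by blast
  qed
  then have "card {e \<in> edges I. i \<in> {fst e, snd e}} \<le> card ((\<lambda>j. (min i j, max i j)) ` (I - {i}))"
    using assms(1) by (intro card_mono) auto
  also have "\<dots> = card (I - {i})" by (rule card_image[OF inj_on_min_max])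
  finally show ?thesis using assms by simp
qed

lemma avg_PiE_prod:
  assumes "finite I" "finite V" "V \<noteq> {}"
  shows "avg (PiE I (\<lambda>_. V)) (\<lambda>x. \<Prod>j\<in>I. g (x j)) = avg V g ^ card I"
  using assms(1)
proof (induction I rule: finite_induct)
  case empty
  show ?case by (simp only: avg_PiE_empty) simp
next
  case (insert a I)
  have "(\<Prod>j\<in>insert a I. g ((x(a := y)) j)) = g y * (\<Prod>j\<in>I. g (x j))" for x y
    using insert.hyps by (simp, intro disjI2 prod.cong) auto
  then show ?case
    using insert by (simp add: avg_PiE_insert avg_mult_right avg_mult_left del: fun_upd_apply)
qed

lemma powr_inverse_power:
  fixes x :: real
  assumes "x \<ge> 0" "n > 0"
  shows "(x ^ n) powr (1 / real n) = x"
  using assms by (cases "x = 0") (simp_all add: powr_realpow[symmetric] powr_powr)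

text \<open>Each vertex of a clique on \<open>m + 1\<close> vertices lies on at most
  \<open>m\<close> edges, so Finner's inequality applies with exponent \<open>1 / m\<close> on every
  edge, and only the moment of order \<open>m\<close> of \<open>W\<close> enters.\<close>

lemma clique_density_le:
  assumes I: "finite I" "card I = Suc m" and m: "m > 0" and V: "finite V" "V \<noteq> {}"
    and W: "\<And>u w. 0 \<le> W u w" and q: "0 \<le> q"
    and le: "avg V (\<lambda>u. avg V (\<lambda>w. W u w ^ m)) \<le> q ^ m"
  shows "avg (PiE I (\<lambda>_. V)) (\<lambda>x. \<Prod>(i, j)\<in>edges I. W (x i) (x j)) \<le> q ^ card (edges I)"
proof -
  let ?P = "PiE I (\<lambda>_. V)"
  have "avg ?P (\<lambda>x. \<Prod>(i, j)\<in>edges I. W (x i) (x j))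
      = avg ?P (\<lambda>x. \<Prod>e\<in>edges I. (W (x (fst e)) (x (snd e)) ^ m) powr (1 / real m))"
    using W m by (simp add: powr_inverse_power case_prod_unfold)
  also have "\<dots> \<le> (\<Prod>e\<in>edges I. avg ?P (\<lambda>x. W (x (fst e)) (x (snd e)) ^ m) powr (1 / real m))"
  proof (rule finner_avg[where S = "\<lambda>e. {fst e, snd e}"])
    fix i assume "i \<in> I"
    then have "card {e \<in> edges I. i \<in> {fst e, snd e}} \<le> m" using edges_degree[OF I(1)] I by fastforce
    then show "(\<Sum>e\<in>{e \<in> edges I. i \<in> {fst e, snd e}}. 1 / real m) \<le> 1"
      using m by (simp add: field_simps)
  qed (use I V W m in auto)
  also have "\<dots> \<le> (\<Prod>e\<in>edges I. q)"
  proof (intro prod_mono conjI)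
    fix e assume "e \<in> edges I"
    then have "avg ?P (\<lambda>x. W (x (fst e)) (x (snd e)) ^ m) = avg V (\<lambda>u. avg V (\<lambda>w. W u w ^ m))"
      using I V by (intro avg_PiE_two) (auto simp: edges_def)
    then have "avg ?P (\<lambda>x. W (x (fst e)) (x (snd e)) ^ m) powr (1 / real m) \<le> (q ^ m) powr (1 / real m)"
      using le W by (intro powr_mono2) (auto intro!: avg_nonneg)
    then show "avg ?P (\<lambda>x. W (x (fst e)) (x (snd e)) ^ m) powr (1 / real m) \<le> q"
      using q m by (simp add: powr_inverse_power)
  qed simp
  finally show ?thesis by simp
qed

text \<open>
  All edges at \<open>a\<close> have exponent \<open>1 / N\<close> except \<open>ab\<close>, which takes over the unused exponent of the
  constant edge \<open>ac\<close> and so enters with \<open>2 / N\<close>. After averaging over the variable of \<open>a\<close>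
  it leaves the squared degree at \<open>b\<close>, whose average is the gain \<open>\<gamma>\<close>.
\<close>

lemma mixed_clique_density_le:
  fixes K :: "nat \<Rightarrow> nat \<Rightarrow> 'a \<Rightarrow> 'a \<Rightarrow> real"
  assumes I: "finite I" "card I = Suc N" and N: "N \<ge> 2" and V: "finite V" "V \<noteq> {}"
    and K0: "\<And>i j u w. 0 \<le> K i j u w" and Ksym: "\<And>i j u w. K i j u w = K j i w u"
    and abc: "a \<in> I" "b \<in> I" "c \<in> I" "a \<noteq> b" "a \<noteq> c" "b \<noteq> c"
    and p: "p > 0" and C: "C \<ge> 1" and \<gamma>: "\<gamma> \<ge> 0"
    and KN: "\<And>i j. avg V (\<lambda>u. avg V (\<lambda>w. K i j u w ^ N)) \<le> C * p ^ N"
    and Kac: "\<And>u w. K a c u w = p" and Kab: "\<And>u w. K a b u w \<le> 1"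
    and deg: "avg V (\<lambda>w. (avg V (\<lambda>u. K a b u w))\<^sup>2) \<le> \<gamma> * p ^ N"
  shows "avg (PiE I (\<lambda>_. V)) (\<lambda>x. \<Prod>(i, j)\<in>edges I. K i j (x i) (x j))
      \<le> C ^ card (edges I) * \<gamma> powr (1 / real N) * p ^ card (edges I)"
proof -
  define J where "J = I - {a}"
  have J: "finite J" "a \<notin> J" "insert a J = I" "card J = N" "b \<in> J" "c \<in> J"
    using I abc by (auto simp: J_def)
  let ?P = "PiE J (\<lambda>_. V)"
  \<comment> \<open>\<open>h j t\<close> is the \<open>N\<close>-th power of the factor that the
    edge \<open>aj\<close> leaves, as a function of the image \<open>t\<close> of \<open>j\<close>,
    once the variable of \<open>a\<close> has been averaged out.\<close>
  define h where "h j t = (if j = c then p ^ N else if j = b then (avg V (\<lambda>y. K a b y t))\<^sup>2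
    else avg V (\<lambda>y. K a j y t ^ N))" for j t
  have h0: "0 \<le> h j t" for j t using p K0 by (auto simp: h_def intro!: avg_nonneg)
  have inner: "avg V (\<lambda>y. \<Prod>j\<in>J. K a j y (x j)) \<le> (\<Prod>j\<in>J. h j (x j) powr (1 / real N))" for x
  proof -
    define f where "f j y = (if j = b then K a b y (x b) else K a j y (x j) ^ N)" for j y
    \<comment> \<open>The edge to \<open>c\<close> is constant and needs no exponent; the other
      \<open>N - 2\<close> neighbours with \<open>1 / N\<close> and \<open>b\<close> with
      \<open>2 / N\<close> use up exactly 1.\<close>
    define w where "w j = (if j = b then 2 / real N else 1 / real N)" for j
    have f0: "0 \<le> f j y" for j y using K0 by (simp add: f_def)
    have split: "(\<Prod>j\<in>J. g j) = g c * (\<Prod>j\<in>J - {c}. g j)" for g :: "nat \<Rightarrow> real"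
      using J by (intro prod.remove) auto
    have sumw: "sum w (J - {c}) = 1"
    proof -
      have "sum w (J - {c}) = w b + sum w (J - {c} - {b})" using J abc by (intro sum.remove) auto
      also have "sum w (J - {c} - {b}) = (\<Sum>j\<in>J - {c} - {b}. 1 / real N)"
        by (intro sum.cong) (auto simp: w_def)
      also have "card (J - {c} - {b}) = N - 2" using J abc by simp
      then have "(\<Sum>j\<in>J - {c} - {b}. 1 / real N) = (real N - 2) / real N" using N by simp
      finally show ?thesis using N by (simp add: w_def field_simps)
    qed
    \<comment> \<open>At \<open>b\<close> this holds because \<open>K a b\<close> lies in
      \<open>[0, 1]\<close> and \<open>2 / N\<close> is at most 1.\<close>
    have fle: "K a j y (x j) \<le> f j y powr w j" for j y
    proof (cases "j = b")
      case True
      show ?thesis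
      proof (cases "K a b y (x b) = 0")
        case False
        then have "K a b y (x b) > 0" using K0[of a b y "x b"] by linarith
        then have "K a b y (x b) powr 1 \<le> K a b y (x b) powr (2 / real N)"
          using Kab[of y "x b"] N by (intro powr_mono') auto
        then show ?thesis using True \<open>K a b y (x b) > 0\<close> by (simp add: f_def w_def)
      qed (simp add: True f_def w_def)
    qed (use K0 N in \<open>simp add: f_def w_def powr_inverse_power\<close>)
    have "avg V (\<lambda>y. \<Prod>j\<in>J. K a j y (x j)) = p * avg V (\<lambda>y. \<Prod>j\<in>J - {c}. K a j y (x j))"
      by (simp only: split Kac avg_mult_left)
    also have "\<dots> \<le> p * avg V (\<lambda>y. \<Prod>j\<in>J - {c}. f j y powr w j)"
      using p K0 fle by (intro mult_left_mono avg_mono prod_mono) auto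
    also have "\<dots> \<le> p * (\<Prod>j\<in>J - {c}. avg V (f j) powr w j)"
      using p V J f0 sumw N by (intro mult_left_mono hoelder_avg) (auto simp: w_def)
    also have "(\<Prod>j\<in>J - {c}. avg V (f j) powr w j) = (\<Prod>j\<in>J - {c}. h j (x j) powr (1 / real N))"
    proof (intro prod.cong refl)
      fix j assume j: "j \<in> J - {c}"
      show "avg V (f j) powr w j = h j (x j) powr (1 / real N)"
      proof (cases "j = b")
        case True
        define D where "D = avg V (\<lambda>y. K a b y (x b))"
        have "D \<ge> 0" using K0 by (simp add: D_def avg_nonneg)
        then have "D powr (2 / real N) = (D\<^sup>2) powr (1 / real N)"
          by (cases "D = 0") (simp_all add: powr_powr powr_realpow[symmetric] del: powr_numeral)
        then show ?thesis using True abc by (simp add: f_def[abs_def] w_def h_def D_def)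
      qed (use j in \<open>simp add: f_def[abs_def] w_def h_def\<close>)
    qed
    also have "p = h c (x c) powr (1 / real N)"
      using p N by (simp add: h_def powr_inverse_power)
    finally show ?thesis by (simp only: split)
  qed
  \<comment> \<open>The factors \<open>h j\<close> are treated as loops at \<open>j\<close>. A
    vertex of \<open>J\<close> meets at most \<open>N - 1\<close> edges and one loop, so exponent
    \<open>1 / N\<close> is again admissible in Finner's inequality.\<close>
  define E where "E = {(i, j). i \<in> J \<and> j \<in> J \<and> i \<le> j}"
  define D where "D = (\<lambda>j. (j, j)) ` J"
  have E_eq: "E = edges J \<union> D" by (auto simp: E_def D_def edges_def)
  have disj: "edges J \<inter> D = {}" by (auto simp: D_def edges_def)
  have finE: "finite E" "finite D" using J by (auto simp: E_eq D_def)
  define F where "F e x = (if fst e = snd e then h (fst e) (x (fst e))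
      else K (fst e) (snd e) (x (fst e)) (x (snd e)) ^ N)" for e and x :: "nat \<Rightarrow> 'a"
  have prodE: "(\<Prod>e\<in>E. g e) = (\<Prod>e\<in>edges J. g e) * (\<Prod>j\<in>J. g (j, j))" for g :: "nat \<times> nat \<Rightarrow> real"
    unfolding E_eq using finE J disj
    by (subst prod.union_disjoint) (auto simp: D_def prod.reindex inj_on_def)
  have edge_neq: "fst e \<noteq> snd e" if "e \<in> edges J" for e using that by (auto simp: edges_def)
  have "avg (PiE I (\<lambda>_. V)) (\<lambda>x. \<Prod>(i, j)\<in>edges I. K i j (x i) (x j))
      = avg ?P (\<lambda>x. (\<Prod>(i, j)\<in>edges J. K i j (x i) (x j)) * avg V (\<lambda>y. \<Prod>j\<in>J. K a j y (x j)))"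
  proof -
    have "(\<Prod>(i, j)\<in>edges I. K i j ((x(a := y)) i) ((x(a := y)) j))
       = (\<Prod>(i, j)\<in>edges J. K i j (x i) (x j)) * (\<Prod>j\<in>J. K a j y (x j))" for x y
      unfolding J(3)[symmetric]
      by (subst prod_edges_insert[OF J(1,2)], rule Ksym, rule arg_cong2[of _ _ _ _ "(*)"])
        (use J(2) in \<open>auto intro!: prod.cong simp: edges_def\<close>)
    then show ?thesis
      unfolding avg_mult_left[symmetric] avg_PiE_insert[OF J(1,2), unfolded J(3)] by simp
  qed
  also have "\<dots> \<le> avg ?P (\<lambda>x. (\<Prod>(i, j)\<in>edges J. K i j (x i) (x j)) * (\<Prod>j\<in>J. h j (x j) powr (1 / real N)))"
    using K0 inner by (intro avg_mono mult_left_mono prod_nonneg) auto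
  also have "\<dots> = avg ?P (\<lambda>x. \<Prod>e\<in>E. F e x powr (1 / real N))"
    unfolding prodE using K0 N edge_neq
    by (intro avg_cong arg_cong2[of _ _ _ _ "(*)"] prod.cong refl)
      (auto simp: F_def powr_inverse_power)
  also have "\<dots> \<le> (\<Prod>e\<in>E. avg ?P (F e) powr (1 / real N))"
  proof (rule finner_avg[where S = "\<lambda>e. {fst e, snd e}"])
    fix i assume i: "i \<in> J"
    have "{e \<in> E. i \<in> {fst e, snd e}} = insert (i, i) {e \<in> edges J. i \<in> {fst e, snd e}}"
      using i by (auto simp: E_def edges_def)
    then have "card {e \<in> E. i \<in> {fst e, snd e}} \<le> Suc (card {e \<in> edges J. i \<in> {fst e, snd e}})"
      by (simp only: card_insert_le_m1[of "Suc m" for m] zero_less_Suc diff_Suc_1 order_refl)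
    also have "\<dots> \<le> N" using edges_degree[OF J(1) i] J(4) N by linarith
    finally show "(\<Sum>e\<in>{e \<in> E. i \<in> {fst e, snd e}}. 1 / real N) \<le> 1"
      using N by (simp add: field_simps)
  qed (use J V finE N K0 h0 in \<open>auto simp: F_def\<close>)
  also have "\<dots> = (\<Prod>e\<in>edges J. avg ?P (F e) powr (1 / real N))
      * (avg ?P (F (b, b)) powr (1 / real N) * (\<Prod>j\<in>J - {b}. avg ?P (F (j, j)) powr (1 / real N)))"
    unfolding prodE using J by (subst prod.remove[of J b]) auto
  \<comment> \<open>Every edge and loop gives at most \<open>C * p\<close>, except the loop at
    \<open>b\<close>, which gives the gain. There are \<open>card (edges J) + N\<close> factors
    \<open>p\<close>, one for each edge of \<open>I\<close>.\<close>
  also have "\<dots> \<le> (\<Prod>e\<in>edges J. C * p) * ((\<gamma> powr (1 / real N) * p) * (\<Prod>j\<in>J - {b}. C * p))"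
  proof -
    have C1: "z powr (1 / real N) \<le> C * p" if "z \<le> C * p ^ N" "0 \<le> z" for z
    proof -
      have "z powr (1 / real N) \<le> (C ^ N * p ^ N) powr (1 / real N)"
        using that C p N self_le_power[of C N]
        by (intro powr_mono2 order.trans[OF that(1)] mult_right_mono) auto
      then show ?thesis using C p N by (simp add: power_mult_distrib[symmetric] powr_inverse_power)
    qed
    have F1: "avg ?P (F e) \<le> C * p ^ N" if "e \<in> edges J" for e
    proof -
      have "avg ?P (F e) = avg V (\<lambda>u. avg V (\<lambda>w. K (fst e) (snd e) u w ^ N))"
        unfolding F_def using that J V edge_neq[OF that]
        by (simp, intro avg_PiE_two) (auto simp: edges_def)
      then show ?thesis using KN by simp
    qed
    have F2: "avg ?P (F (j, j)) = avg V (h j)" if "j \<in> J" for j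
      unfolding F_def using that J V by (simp add: avg_PiE_one)
    have F3: "avg V (h j) \<le> C * p ^ N" if "j \<in> J - {b}" for j
    proof (cases "j = c")
      case True
      then show ?thesis using V C p by (simp add: h_def[abs_def] avg_const mult_right_mono)
    next
      case False
      then have "avg V (h j) = avg V (\<lambda>t. avg V (\<lambda>y. K a j y t ^ N))"
        using that by (simp add: h_def[abs_def])
      also have "\<dots> = avg V (\<lambda>y. avg V (\<lambda>t. K a j y t ^ N))" by (rule avg_swap)
      finally show ?thesis using KN by simp
    qed
    have "avg V (h b) \<le> \<gamma> * p ^ N" using deg abc by (simp add: h_def[abs_def])
    then have "avg V (h b) powr (1 / real N) \<le> (\<gamma> * p ^ N) powr (1 / real N)"
      using h0 by (intro powr_mono2 avg_nonneg) auto
    also have "\<dots> = \<gamma> powr (1 / real N) * p"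
      using p N \<gamma> by (simp add: powr_mult powr_inverse_power)
    finally have F4: "avg V (h b) powr (1 / real N) \<le> \<gamma> powr (1 / real N) * p" .
    have F0: "0 \<le> avg ?P (F e)" for e using K0 h0 by (auto simp: F_def intro!: avg_nonneg)
    show ?thesis
      using F1 F2 F3 F4 J C1 F0 p C \<gamma> h0
      by (intro mult_mono prod_mono conjI C1 mult_nonneg_nonneg prod_nonneg)
        (auto intro: avg_nonneg)
  qed
  also have "\<dots> = C ^ (card (edges J) + (N - 1)) * \<gamma> powr (1 / real N) * p ^ (card (edges J) + N)"
    using J N by (cases N) (simp_all add: power_mult_distrib power_add algebra_simps)
  also have "card (edges J) + N = card (edges I)"
    using J card_edges_insert[of J a] by simp
  also have "C ^ (card (edges J) + (N - 1)) * \<gamma> powr (1 / real N) * p ^ card (edges I)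
      \<le> C ^ card (edges I) * \<gamma> powr (1 / real N) * p ^ card (edges I)"
    using C p J card_edges_insert[of J a] by (intro mult_right_mono power_increasing) auto
  finally show ?thesis .
qed

text \<open>Otherwise a vertex meeting \<open>F\<close> would be joined by \<open>F\<close> to all
  others. One edge of \<open>F\<close> provides such a vertex; then every vertex meets
  \<open>F\<close>, and \<open>F\<close> is the full clique.\<close>

lemma exists_mixed_vertex:
  assumes "F \<subseteq> edges I" "F \<noteq> {}" "F \<noteq> edges I"
  obtains a b c where "a \<in> I" "b \<in> I" "c \<in> I" "a \<noteq> b" "a \<noteq> c" "b \<noteq> c"
    "(min a b, max a b) \<in> F" "(min a c, max a c) \<notin> F"
proof -
  define adj where "adj i j \<longleftrightarrow> (min i j, max i j) \<in> F" for i j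
  have sym: "adj i j \<longleftrightarrow> adj j i" for i j by (simp add: adj_def min.commute max.commute)
  have "\<exists>a\<in>I. \<exists>b\<in>I. \<exists>c\<in>I. a \<noteq> b \<and> a \<noteq> c \<and> b \<noteq> c \<and> adj a b \<and> \<not> adj a c"
  proof (rule ccontr)
    assume "\<not> ?thesis"
    then have H: "adj a c" if "a \<in> I" "b \<in> I" "c \<in> I" "a \<noteq> b" "a \<noteq> c" "adj a b" for a b c
      using that by (cases "b = c") auto
    obtain i j where ij: "(i, j) \<in> F" using assms(2) by auto
    then have ij': "i \<in> I" "j \<in> I" "i < j" using assms(1) by (auto simp: edges_def)
    then have "adj i j" using ij by (simp add: adj_def min_def max_def)
    then have i: "adj i l" if "l \<in> I" "l \<noteq> i" for l using H[of i j l] ij' that by auto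
    have "adj l m" if "l \<in> I" "m \<in> I" "l \<noteq> m" for l m
      using i[of l] i[of m] H[of l i m] sym that ij'(1) by (cases "l = i") auto
    then have "edges I \<subseteq> F" by (force simp: edges_def adj_def min_def max_def)
    then show False using assms by auto
  qed
  then show ?thesis using that unfolding adj_def by blast
qed

text \<open>The product is expanded over the set \<open>F\<close> of edges on which \<open>U\<close>
  rather than \<open>p\<close> is chosen. The three summands bound the empty \<open>F\<close>, the
  full \<open>F\<close>, and all remaining \<open>F\<close> together.\<close>

lemma low_degree_clique_density:
  fixes U :: "'a \<Rightarrow> 'a \<Rightarrow> real"
  assumes I: "finite I" "card I = Suc N" and N: "N \<ge> 2" and V: "finite V" "V \<noteq> {}"
    and U: "\<And>u w. 0 \<le> U u w" "\<And>u w. U u w \<le> 1" "\<And>u w. U u w = U w u"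
    and p: "0 < p" "p \<le> 1" and C: "C \<ge> 1" and \<gamma>: "\<gamma> \<ge> 0"
    and U2: "avg V (\<lambda>u. avg V (\<lambda>w. (U u w)\<^sup>2)) \<le> C * p ^ N"
    and deg: "avg V (\<lambda>w. (avg V (\<lambda>u. U u w))\<^sup>2) \<le> \<gamma> * p ^ N"
  shows "avg (PiE I (\<lambda>_. V)) (\<lambda>x. \<Prod>(i, j)\<in>edges I. p + U (x i) (x j))
      \<le> p ^ card (edges I)
        + avg V (\<lambda>u. avg V (\<lambda>w. (U u w)\<^sup>2)) powr (real (card (edges I)) / real N)
        + 2 ^ card (edges I) * (C ^ card (edges I) * \<gamma> powr (1 / real N) * p ^ card (edges I))"
proof -
  let ?E = "edges I" and ?P = "PiE I (\<lambda>_. V)"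
  define e where "e = card ?E"
  define Z where "Z = avg V (\<lambda>u. avg V (\<lambda>w. (U u w)\<^sup>2))"
  \<comment> \<open>The use of \<open>min\<close> and \<open>max\<close> makes the factor
    independent of the direction in which an edge is read, as the bound for mixed \<open>F\<close>
    demands.\<close>
  define K where "K F i j u w = (if (min i j, max i j) \<in> F then U u w else p)" for F and i j :: nat and u w
  define T where "T F = avg ?P (\<lambda>x. \<Prod>(i, j)\<in>?E. K F i j (x i) (x j))" for F
  have finE: "finite ?E" using I by simp
  have expand: "(\<Prod>(i, j)\<in>?E. p + U (x i) (x j)) = (\<Sum>F\<in>Pow ?E. \<Prod>(i, j)\<in>?E. K F i j (x i) (x j))" for x
  proof -
    have "(\<Prod>(i, j)\<in>?E. p + U (x i) (x j)) = (\<Prod>e\<in>?E. U (x (fst e)) (x (snd e)) + p)"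
      by (simp add: case_prod_unfold add.commute)
    also have "\<dots> = (\<Sum>F\<in>Pow ?E. (\<Prod>e\<in>F. U (x (fst e)) (x (snd e))) * (\<Prod>e\<in>?E - F. p))"
      by (rule prod_add[OF finE])
    also have "\<dots> = (\<Sum>F\<in>Pow ?E. \<Prod>(i, j)\<in>?E. K F i j (x i) (x j))"
    proof (intro sum.cong refl)
      fix F assume F: "F \<in> Pow ?E"
      have K: "K F (fst e) (snd e) u w = (if e \<in> F then U u w else p)" if "e \<in> ?E" for e u w
        using that by (auto simp: K_def edges_def min_def max_def)
      have "(\<Prod>(i, j)\<in>?E. K F i j (x i) (x j))
          = (\<Prod>e\<in>F. K F (fst e) (snd e) (x (fst e)) (x (snd e)))
          * (\<Prod>e\<in>?E - F. K F (fst e) (snd e) (x (fst e)) (x (snd e)))"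
        using F finE prod.subset_diff[of F ?E] by (simp add: case_prod_unfold mult.commute)
      also have "\<dots> = (\<Prod>e\<in>F. U (x (fst e)) (x (snd e))) * (\<Prod>e\<in>?E - F. p)"
        using F K by (intro arg_cong2[of _ _ _ _ "(*)"] prod.cong) auto
      finally show "(\<Prod>e\<in>F. U (x (fst e)) (x (snd e))) * (\<Prod>e\<in>?E - F. p)
          = (\<Prod>(i, j)\<in>?E. K F i j (x i) (x j))" by simp
    qed
    finally show ?thesis .
  qed
  have K0: "0 \<le> K F i j u w" for F i j u w using U p by (simp add: K_def)
  have T_empty: "T {} = p ^ e"
    using finite_funcset[OF I(1) V(1)] V
    by (simp add: T_def K_def e_def avg_const PiE_eq_empty_iff case_prod_unfold)
  have T_full: "T ?E \<le> Z powr (real e / real N)"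
  proof -
    define Y where "Y = avg V (\<lambda>u. avg V (\<lambda>w. U u w ^ N))"
    \<comment> \<open>Since \<open>U\<close> takes values in \<open>[0, 1]\<close> and
      \<open>N\<close> is at least 2, the moment of order \<open>N\<close> is at most the second
      moment.\<close>
    have Y: "0 \<le> Y" "Y \<le> Z"
      unfolding Y_def Z_def using U N by (auto intro!: avg_nonneg avg_mono power_decreasing)
    have root: "(Y powr (1 / real N)) ^ N = Y"
      using Y N by (cases "Y = 0") (simp_all add: powr_realpow[symmetric] powr_powr)
    have "T ?E = avg ?P (\<lambda>x. \<Prod>(i, j)\<in>?E. U (x i) (x j))"
      unfolding T_def by (intro avg_cong prod.cong refl) (auto simp: K_def edges_def min_def max_def)
    also have "\<dots> \<le> (Y powr (1 / real N)) ^ card ?E"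
      using I N V U root by (intro clique_density_le[where m = N]) (auto simp: Y_def)
    also have "\<dots> = Y powr (real e / real N)"
    proof (cases "Y = 0")
      case True
      have "card ?E > 0"
        using card_edges[OF I(1)] I N by (cases "card ?E") auto
      then show ?thesis using True by (simp add: e_def)
    qed (use Y in \<open>simp add: powr_realpow[symmetric] powr_powr e_def\<close>)
    also have "\<dots> \<le> Z powr (real e / real N)" using Y by (intro powr_mono2) auto
    finally show ?thesis .
  qed
  have T_mixed: "T F \<le> C ^ e * \<gamma> powr (1 / real N) * p ^ e" if F: "F \<in> Pow ?E - {{}, ?E}" for F
  proof -
    obtain a b c where abc: "a \<in> I" "b \<in> I" "c \<in> I" "a \<noteq> b" "a \<noteq> c" "b \<noteq> c"
      "(min a b, max a b) \<in> F" "(min a c, max a c) \<notin> F"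
      using exists_mixed_vertex[of F I] F by auto
    show ?thesis unfolding T_def e_def
    proof (rule mixed_clique_density_le[OF I N V K0 _ abc(1-6) p(1) C \<gamma>])
      show "K F i j u w = K F j i w u" for i j u w
        using U(3)[of u w] by (simp add: K_def min.commute max.commute)
      show "K F a c u w = p" "K F a b u w \<le> 1" for u w using abc U by (simp_all add: K_def)
      show "avg V (\<lambda>w. (avg V (\<lambda>u. K F a b u w))\<^sup>2) \<le> \<gamma> * p ^ N"
        using deg abc by (simp add: K_def)
      \<comment> \<open>An edge of \<open>F\<close> is controlled by the second moment of
        \<open>U\<close>, any other edge by \<open>p ^ N\<close> and
        \<open>C \<ge> 1\<close>.\<close>
      show "avg V (\<lambda>u. avg V (\<lambda>w. K F i j u w ^ N)) \<le> C * p ^ N" for i j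
      proof (cases "(min i j, max i j) \<in> F")
        case True
        then have "avg V (\<lambda>u. avg V (\<lambda>w. K F i j u w ^ N)) \<le> avg V (\<lambda>u. avg V (\<lambda>w. (U u w)\<^sup>2))"
          using U N by (auto simp: K_def intro!: avg_mono power_decreasing)
        then show ?thesis using U2 by simp
      next
        case False
        then show ?thesis using V C p by (simp add: K_def avg_const mult_right_mono)
      qed
    qed
  qed
  have E_ne: "?E \<noteq> {}" using card_edges[OF I(1)] I N by auto
  have "avg ?P (\<lambda>x. \<Prod>(i, j)\<in>?E. p + U (x i) (x j)) = (\<Sum>F\<in>Pow ?E. T F)"
    unfolding expand T_def by (rule avg_sum)
  also have "\<dots> = T {} + (T ?E + (\<Sum>F\<in>Pow ?E - {{}, ?E}. T F))"
    using finE E_ne by (subst sum.remove[of _ "{}"], simp, simp, subst sum.remove[of _ ?E])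
      (auto simp: insert_commute Diff_insert[symmetric])
  also have "(\<Sum>F\<in>Pow ?E - {{}, ?E}. T F) \<le> (\<Sum>F\<in>Pow ?E - {{}, ?E}. C ^ e * \<gamma> powr (1 / real N) * p ^ e)"
    by (intro sum_mono T_mixed)
  also have "\<dots> \<le> 2 ^ e * (C ^ e * \<gamma> powr (1 / real N) * p ^ e)"
  proof -
    have "card (Pow ?E - {{}, ?E}) \<le> card (Pow ?E)" using finE by (intro card_mono) auto
    then have "real (card (Pow ?E - {{}, ?E})) \<le> 2 ^ e"
      using finE by (metis card_Pow e_def of_nat_le_iff of_nat_numeral of_nat_power)
    then show ?thesis using C p by (simp only: sum_constant) (intro mult_right_mono; simp)
  qed
  finally show ?thesis using T_empty T_full by (simp add: e_def Z_def)
qed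

text \<open>This prices the tuples whose vertex \<open>i\<close> is sent to a hub, \<open>g\<close>
  being the indicator of the hubs in the application. The clique on the other vertices is replaced
  by its minimum possible weight, the excess over that minimum being kept as an error; the edges at
  the root then average independently.\<close>

lemma rooted_clique_density:
  fixes W :: "'a \<Rightarrow> 'a \<Rightarrow> real"
  assumes I: "finite I" "card I = Suc N" "i \<in> I" and N: "N \<ge> 2" and V: "finite V" "V \<noteq> {}"
    and W: "\<And>u w. q \<le> W u w" "\<And>u w. W u w \<le> 1" "\<And>u w. W u w = W w u" and q: "0 \<le> q"
    and g: "\<And>u. 0 \<le> g u"
  shows "avg (PiE I (\<lambda>_. V)) (\<lambda>x. g (x i) * (\<Prod>(i, j)\<in>edges I. W (x i) (x j)))
    \<le> avg V (\<lambda>u. g u * (q ^ card (edges (I - {i})) * avg V (\<lambda>w. (W u w)\<^sup>2)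
        + (avg (PiE (I - {i}) (\<lambda>_. V)) (\<lambda>x. \<Prod>(i, j)\<in>edges (I - {i}). W (x i) (x j))
           - q ^ card (edges (I - {i})))))"
proof -
  define J where "J = I - {i}"
  have J: "finite J" "i \<notin> J" "insert i J = I" "card J = N" using I by (auto simp: J_def)
  let ?P = "PiE J (\<lambda>_. V)"
  have P: "finite ?P" "?P \<noteq> {}" using J V by (auto simp: finite_funcset PiE_eq_empty_iff)
  define H where "H x = (\<Prod>(i, j)\<in>edges J. W (x i) (x j))" for x
  define r where "r = q ^ card (edges J)"
  have W0: "0 \<le> W u w" for u w using W(1)[of u w] q by linarith
  have Hr: "r \<le> H x" for x
  proof -
    have "(\<Prod>e\<in>edges J. q) \<le> H x"
      unfolding H_def using W q by (intro prod_mono) auto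
    then show ?thesis by (simp add: r_def)
  qed
  have split: "(\<Prod>(i', j)\<in>edges I. W ((x(i := y)) i') ((x(i := y)) j)) = H x * (\<Prod>j\<in>J. W y (x j))" for x y
  proof -
    have "(\<Prod>(i', j)\<in>edges (insert i J). W ((x(i := y)) i') ((x(i := y)) j))
        = (\<Prod>(i', j)\<in>edges J. W ((x(i := y)) i') ((x(i := y)) j))
          * (\<Prod>j\<in>J. W ((x(i := y)) i) ((x(i := y)) j))"
      by (rule prod_edges_insert[OF J(1,2)]) (rule W(3))
    also have "\<dots> = H x * (\<Prod>j\<in>J. W y (x j))"
      unfolding H_def using J(2)
      by (intro arg_cong2[of _ _ _ _ "(*)"] prod.cong refl) (auto simp: edges_def)
    finally show ?thesis by (simp only: J(3))
  qed
  have "avg (PiE I (\<lambda>_. V)) (\<lambda>x. g (x i) * (\<Prod>(i, j)\<in>edges I. W (x i) (x j)))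
      = avg ?P (\<lambda>x. avg V (\<lambda>y. g y * (H x * (\<Prod>j\<in>J. W y (x j)))))"
    unfolding avg_PiE_insert[OF J(1,2), unfolded J(3)] split by simp
  also have "\<dots> = avg V (\<lambda>y. avg ?P (\<lambda>x. g y * (H x * (\<Prod>j\<in>J. W y (x j)))))" by (rule avg_swap)
  also have "\<dots> \<le> avg V (\<lambda>u. g u * (r * avg V (\<lambda>w. (W u w)\<^sup>2) + (avg ?P H - r)))"
  proof (intro avg_mono)
    fix y
    \<comment> \<open>This is \<open>(H x - r) * (1 - P) \<ge> 0\<close> for the product
      \<open>P\<close> of the root edges, which is at most 1.\<close>
    have "H x * (\<Prod>j\<in>J. W y (x j)) \<le> r * (\<Prod>j\<in>J. W y (x j)) + (H x - r)" for x
    proof -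
      have "(\<Prod>j\<in>J. W y (x j)) \<le> 1" using W W0 by (intro prod_le_1) auto
      then have "(H x - r) * (\<Prod>j\<in>J. W y (x j)) \<le> (H x - r) * 1"
        using Hr[of x] by (intro mult_left_mono) auto
      then show ?thesis by (simp add: algebra_simps)
    qed
    then have "avg ?P (\<lambda>x. H x * (\<Prod>j\<in>J. W y (x j)))
        \<le> avg ?P (\<lambda>x. r * (\<Prod>j\<in>J. W y (x j)) + (H x - r))" by (intro avg_mono)
    also have "\<dots> = r * avg V (W y) ^ N + (avg ?P H - r)"
      using avg_PiE_prod[OF J(1) V, of "W y"] J(4)
      by (simp only: avg_add avg_diff avg_mult_left avg_const[OF P])
    \<comment> \<open>The normalised degree is in \<open>[0, 1]\<close>, so its \<open>N\<close>-th
      power is at most its square, and the square is at most the mean of the squares.\<close>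
    also have "\<dots> \<le> r * avg V (\<lambda>w. (W y w)\<^sup>2) + (avg ?P H - r)"
    proof -
      have "avg V (W y) ^ N \<le> avg V (W y) ^ 2"
        using N V W W0 by (intro power_decreasing avg_nonneg avg_le_const) auto
      also have "\<dots> \<le> avg V (\<lambda>w. (W y w)\<^sup>2)" by (rule avg_square_le[OF V])
      finally show ?thesis using q by (simp add: r_def mult_left_mono)
    qed
    finally show "avg ?P (\<lambda>x. g y * (H x * (\<Prod>j\<in>J. W y (x j))))
        \<le> g y * (r * avg V (\<lambda>w. (W y w)\<^sup>2) + (avg ?P H - r))"
      unfolding avg_mult_left using g by (rule mult_left_mono)
  qed
  finally show ?thesis by (simp add: J_def r_def H_def[abs_def])
qed

text \<open>Tuples avoiding \<open>B\<close> are handled with the truncated kernel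
  \<open>U'\<close>; the others by a union bound over the vertex sent into \<open>B\<close>, which
  yields the factor \<open>Suc N\<close>. The hypothesis \<open>low\<close> makes the clique left
  after removing that vertex nearly as rare as in the constant graph.\<close>

lemma clique_density_upper:
  fixes U :: "'a \<Rightarrow> 'a \<Rightarrow> real" and B :: "'a set"
  defines "U' \<equiv> \<lambda>u w. if u \<in> B \<or> w \<in> B then 0 else U u w"
  defines "ind \<equiv> \<lambda>u. if u \<in> B then 1 else 0 :: real"
  assumes I: "finite I" "card I = Suc N" and N: "N \<ge> 2" and V: "finite V" "V \<noteq> {}"
    and U: "\<And>u w. 0 \<le> U u w" "\<And>u w. p + U u w \<le> 1" "\<And>u w. U u w = U w u"
    and p: "0 < p" and C: "C \<ge> 1" and \<gamma>: "\<gamma> \<ge> 0" and \<kappa>: "\<kappa> \<ge> 0" and \<beta>: "\<beta> \<ge> 0"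
    and U2: "avg V (\<lambda>u. avg V (\<lambda>w. (U u w)\<^sup>2)) \<le> C * p ^ N"
    and deg: "avg V (\<lambda>w. (1 - ind w) * (avg V (\<lambda>u. U u w))\<^sup>2) \<le> \<gamma> * p ^ N"
    and B: "avg V ind \<le> \<beta> * p ^ N"
    and low: "avg V (\<lambda>u. avg V (\<lambda>w. (p + U u w) ^ (N - 1))) \<le> (p * (1 + \<kappa>)) ^ (N - 1)"
  shows "avg (PiE I (\<lambda>_. V)) (\<lambda>x. \<Prod>(i, j)\<in>edges I. p + U (x i) (x j))
      \<le> p ^ card (edges I)
        + avg V (\<lambda>u. avg V (\<lambda>w. (U' u w)\<^sup>2)) powr (real (card (edges I)) / real N)
        + 2 ^ card (edges I) * (C ^ card (edges I) * \<gamma> powr (1 / real N) * p ^ card (edges I))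
        + real (Suc N) * (p ^ (card (edges I) - N) * (avg V (\<lambda>u. ind u * avg V (\<lambda>w. (U u w)\<^sup>2))
            + \<beta> * p ^ N * (3 * p + ((1 + \<kappa>) ^ card (edges I) - 1))))"
proof -
  let ?P = "PiE I (\<lambda>_. V)"
  define e where "e = card (edges I)"
  define Q where "Q x = (\<Prod>(i, j)\<in>edges I. p + U (x i) (x j))" for x
  define Q' where "Q' x = (\<Prod>(i, j)\<in>edges I. p + U' (x i) (x j))" for x
  have p1: "p \<le> 1" using U(1,2) by (meson add_increasing2 order.trans order_refl)
  have U1: "U u w \<le> 1" for u w using U(2)[of u w] p by linarith
  have U': "0 \<le> U' u w" "U' u w \<le> U u w" "U' u w \<le> 1" "U' u w = U' w u" for u w
    using U U1 by (auto simp: U'_def)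
  have ind: "0 \<le> ind u" for u by (simp add: ind_def)
  have Q0: "0 \<le> Q x" "0 \<le> Q' x" for x
    unfolding Q_def Q'_def using U U' p by (auto intro!: prod_nonneg add_nonneg_nonneg simp: less_imp_le)
  \<comment> \<open>If some vertex hits \<open>B\<close>, one summand already equals
    \<open>Q x\<close>; if none does, truncation has not changed the product.\<close>
  have "Q x \<le> Q' x + (\<Sum>i\<in>I. ind (x i) * Q x)" for x
  proof (cases "\<exists>i\<in>I. x i \<in> B")
    case True
    then obtain i where i: "i \<in> I" "x i \<in> B" by auto
    have "ind (x i) * Q x \<le> (\<Sum>i\<in>I. ind (x i) * Q x)"
      using I i Q0 ind by (intro member_le_sum) auto
    then show ?thesis using i Q0[of x] by (simp add: ind_def)
  next
    case False
    then have "Q x = Q' x" unfolding Q_def Q'_def U'_def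
      by (intro prod.cong refl) (auto simp: edges_def)
    then show ?thesis using Q0 ind by (auto intro!: sum_nonneg)
  qed
  then have "avg ?P Q \<le> avg ?P (\<lambda>x. Q' x + (\<Sum>i\<in>I. ind (x i) * Q x))" by (intro avg_mono)
  also have "\<dots> = avg ?P Q' + (\<Sum>i\<in>I. avg ?P (\<lambda>x. ind (x i) * Q x))"
    by (simp add: avg_add avg_sum)
  also have "avg ?P Q' \<le> p ^ e + avg V (\<lambda>u. avg V (\<lambda>w. (U' u w)\<^sup>2)) powr (real e / real N)
      + 2 ^ e * (C ^ e * \<gamma> powr (1 / real N) * p ^ e)"
    unfolding Q'_def e_def
  proof (rule low_degree_clique_density[OF I N V U'(1,3,4) p p1 C \<gamma>])
    have "avg V (\<lambda>u. avg V (\<lambda>w. (U' u w)\<^sup>2)) \<le> avg V (\<lambda>u. avg V (\<lambda>w. (U u w)\<^sup>2))"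
      using U' by (intro avg_mono power_mono) auto
    then show "avg V (\<lambda>u. avg V (\<lambda>w. (U' u w)\<^sup>2)) \<le> C * p ^ N" using U2 by simp
    have "(avg V (\<lambda>u. U' u w))\<^sup>2 \<le> (1 - ind w) * (avg V (\<lambda>u. U u w))\<^sup>2" for w
    proof (cases "w \<in> B")
      case True
      then show ?thesis using V by (simp add: ind_def U'_def avg_const)
    next
      case False
      then show ?thesis using U' by (auto simp: ind_def intro!: power_mono avg_mono avg_nonneg)
    qed
    then have "avg V (\<lambda>w. (avg V (\<lambda>u. U' u w))\<^sup>2) \<le> avg V (\<lambda>w. (1 - ind w) * (avg V (\<lambda>u. U u w))\<^sup>2)"
      by (intro avg_mono)
    then show "avg V (\<lambda>w. (avg V (\<lambda>u. U' u w))\<^sup>2) \<le> \<gamma> * p ^ N" using deg by simp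
  qed
  also have "(\<Sum>i\<in>I. avg ?P (\<lambda>x. ind (x i) * Q x))
      \<le> (\<Sum>i\<in>I. p ^ (e - N) * (avg V (\<lambda>u. ind u * avg V (\<lambda>w. (U u w)\<^sup>2))
            + \<beta> * p ^ N * (3 * p + ((1 + \<kappa>) ^ e - 1))))"
  proof (intro sum_mono)
    fix i assume i: "i \<in> I"
    define J where "J = I - {i}"
    have J: "finite J" "card J = Suc (N - 1)" "card (edges J) = e - N"
      using I i N card_edges_insert[of J i] by (auto simp: J_def e_def insert_absorb)
    define S where "S = avg (PiE J (\<lambda>_. V)) (\<lambda>x. \<Prod>(i, j)\<in>edges J. p + U (x i) (x j))"
    \<comment> \<open>The clique on \<open>J\<close> has one vertex less, so the moment of order
      \<open>N - 1\<close> suffices, which is what \<open>low\<close> provides.\<close>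
    have "S \<le> (p * (1 + \<kappa>)) ^ card (edges J)"
      unfolding S_def using J N V U p \<kappa> low by (intro clique_density_le[of J "N - 1"]) (auto simp: less_imp_le)
    also have "\<dots> \<le> p ^ (e - N) * (1 + \<kappa>) ^ e"
      unfolding J(3) power_mult_distrib using p \<kappa> by (intro mult_left_mono power_increasing) auto
    finally have S: "S - p ^ (e - N) \<le> p ^ (e - N) * ((1 + \<kappa>) ^ e - 1)" by (simp add: algebra_simps)
    have W2: "avg V (\<lambda>w. (p + U u w)\<^sup>2) \<le> avg V (\<lambda>w. (U u w)\<^sup>2) + 3 * p" for u
    proof -
      \<comment> \<open>The terms \<open>p * p\<close> and \<open>2 * p * U u w\<close> are at most
        \<open>p\<close> and \<open>2 * p\<close>.\<close>
      have "(p + U u w)\<^sup>2 \<le> (U u w)\<^sup>2 + 3 * p" for w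
      proof -
        have "p * p \<le> p * 1" "p * U u w \<le> p * 1" using p p1 U1 by (auto intro: mult_left_mono)
        then show ?thesis by (simp add: power2_eq_square algebra_simps)
      qed
      then have "avg V (\<lambda>w. (p + U u w)\<^sup>2) \<le> avg V (\<lambda>w. (U u w)\<^sup>2 + 3 * p)" by (intro avg_mono)
      then show ?thesis using V by (simp add: avg_add avg_const)
    qed
    have "avg ?P (\<lambda>x. ind (x i) * Q x) \<le> avg V (\<lambda>u. ind u * (p ^ (e - N) * avg V (\<lambda>w. (p + U u w)\<^sup>2)
        + (S - p ^ (e - N))))"
      unfolding Q_def S_def J(3)[symmetric] J_def
      using I i N V U p ind by (intro rooted_clique_density) auto
    also have "\<dots> \<le> avg V (\<lambda>u. ind u * (p ^ (e - N) * (avg V (\<lambda>w. (U u w)\<^sup>2) + 3 * p)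
        + p ^ (e - N) * ((1 + \<kappa>) ^ e - 1)))"
      using ind W2 S p by (intro avg_mono mult_left_mono add_mono) auto
    also have "\<dots> = avg V (\<lambda>u. p ^ (e - N) * (ind u * avg V (\<lambda>w. (U u w)\<^sup>2))
        + ind u * (p ^ (e - N) * (3 * p + ((1 + \<kappa>) ^ e - 1))))"
      by (intro avg_cong) (simp add: algebra_simps)
    also have "\<dots> = p ^ (e - N) * avg V (\<lambda>u. ind u * avg V (\<lambda>w. (U u w)\<^sup>2))
        + avg V ind * (p ^ (e - N) * (3 * p + ((1 + \<kappa>) ^ e - 1)))"
      by (simp only: avg_add avg_mult_left avg_mult_right)
    also have "\<dots> \<le> p ^ (e - N) * avg V (\<lambda>u. ind u * avg V (\<lambda>w. (U u w)\<^sup>2))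
        + \<beta> * p ^ N * (p ^ (e - N) * (3 * p + ((1 + \<kappa>) ^ e - 1)))"
      using p \<kappa> B by (intro add_left_mono mult_right_mono) auto
    finally show "avg ?P (\<lambda>x. ind (x i) * Q x) \<le> p ^ (e - N) * (avg V (\<lambda>u. ind u * avg V (\<lambda>w. (U u w)\<^sup>2))
            + \<beta> * p ^ N * (3 * p + ((1 + \<kappa>) ^ e - 1)))"
      by (simp add: algebra_simps)
  qed
  finally show ?thesis using I by (simp add: Q_def[abs_def] e_def)
qed

section \<open>Entropy lower bounds\<close>

lemma mult_ln_divide_ge:
  fixes a b :: real
  assumes "a \<ge> 0" "b > 0"
  shows "a * ln (a / b) \<ge> a - b"
proof (cases "a = 0")
  case False
  then have a: "a > 0" using assms by simp
  have "ln (b / a) \<le> b / a - 1" using a assms by (intro ln_le_minus_one) auto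
  then have "a * (1 - b / a) \<le> a * ln (a / b)"
    using a assms by (intro mult_left_mono) (auto simp: ln_div)
  moreover have "a * (1 - b / a) = a - b" using a by (simp add: field_simps)
  ultimately show ?thesis by simp
qed (use assms in simp)

text \<open>The Gibbs variational inequality, after bounding \<open>ln (1 - p + p e\<^sup>l)\<close> by \<open>p (e\<^sup>l - 1)\<close>.\<close>

lemma rel_entropy_ge:
  assumes "0 < p" "p < 1" "0 \<le> q" "q \<le> 1"
  shows "rel_entropy p q \<ge> l * q - p * (exp l - 1)"
proof -
  have "q * ln (q / (p * exp l)) \<ge> q - p * exp l"
    using assms by (intro mult_ln_divide_ge) auto
  moreover have "q * ln (q / (p * exp l)) = q * ln (q / p) - l * q"
    using assms by (cases "q = 0") (auto simp: ln_div ln_mult algebra_simps)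
  moreover have "(1 - q) * ln ((1 - q) / (1 - p)) \<ge> (1 - q) - (1 - p)"
    using assms by (intro mult_ln_divide_ge) auto
  ultimately show ?thesis by (simp add: rel_entropy_def algebra_simps)
qed

lemma exp_minus_one_le: "exp l - 1 \<le> l + l\<^sup>2 * exp l" if "l \<ge> 0" for l :: real
proof -
  have "exp l * (1 - l) \<le> exp l * exp (- l)"
    using exp_ge_add_one_self[of "- l"] by (intro mult_left_mono) auto
  then have "exp l - 1 \<le> l * exp l" by (simp add: exp_minus algebra_simps)
  then have "l * (exp l - 1) \<le> l * (l * exp l)" using that by (intro mult_left_mono) auto
  with \<open>exp l - 1 \<le> l * exp l\<close> show ?thesis by (simp add: power2_eq_square algebra_simps)
qed

text \<open>The first-order terms \<open>l * p\<close> cancel in the variational bound, leaving an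
  error of second order in \<open>l\<close>. All entropy bounds below differ only in the choice of
  \<open>l\<close>.\<close>

lemma rel_entropy_add_ge:
  assumes "0 < p" "p < 1" "0 \<le> p + x" "p + x \<le> 1" "l \<ge> 0"
  shows "rel_entropy p (p + x) \<ge> l * x - p * (l\<^sup>2 * exp l)"
proof -
  have "p * (exp l - 1) \<le> p * (l + l\<^sup>2 * exp l)"
    using exp_minus_one_le[OF assms(5)] assms(1) by (intro mult_left_mono) auto
  then show ?thesis
    using rel_entropy_ge[OF assms(1-4), of l] by (simp add: algebra_simps)
qed

lemma rel_entropy_nonneg:
  assumes "0 < p" "p < 1" "0 \<le> q" "q \<le> 1"
  shows "rel_entropy p q \<ge> 0"
  using rel_entropy_ge[OF assms, of 0] by simp

lemma rel_entropy_self: "0 < p \<Longrightarrow> p < 1 \<Longrightarrow> rel_entropy p p = 0"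
  by (simp add: rel_entropy_def)

context
  fixes V :: "'a set" and U :: "'a \<Rightarrow> 'a \<Rightarrow> real" and p :: real
  assumes V: "finite V" "V \<noteq> {}"
    and U: "\<And>u w. 0 \<le> U u w" "\<And>u w. p + U u w \<le> 1"
    and p: "0 < p" "p < 1"
begin

lemma excess_le_1: "U u w \<le> 1"
  using U(2)[of u w] p by linarith

lemma row_entropy_ge:
  assumes "l \<ge> 0"
  shows "avg V (\<lambda>w. rel_entropy p (p + U u w)) \<ge> l * avg V (U u) - p * (l\<^sup>2 * exp l)"
proof -
  have "avg V (\<lambda>w. l * U u w - p * (l\<^sup>2 * exp l)) \<le> avg V (\<lambda>w. rel_entropy p (p + U u w))"
    using p U assms by (intro avg_mono rel_entropy_add_ge) (auto intro: add_nonneg_nonneg less_imp_le)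
  then show ?thesis using V by (simp add: avg_diff avg_mult_left avg_const)
qed

lemma row_entropy_nonneg: "avg V (\<lambda>w. rel_entropy p (p + U u w)) \<ge> 0"
  using row_entropy_ge[of 0 u] by simp

text \<open>The multiplier is chosen entrywise as \<open>s * U u w\<close>, which turns the linear
  gain into a square. With \<open>s\<close> slightly below \<open>ln (1 / p)\<close> the error is
  negligible, so this gives the sharp constant.\<close>

lemma entropy_ge_square:
  assumes "s \<ge> 0"
  shows "avg V (\<lambda>u. avg V (\<lambda>w. (U u w)\<^sup>2)) * (s - p * s\<^sup>2 * exp s)
     \<le> avg V (\<lambda>u. avg V (\<lambda>w. rel_entropy p (p + U u w)))"
  unfolding avg_mult_right[symmetric]
proof (intro avg_mono)
  fix u w
  have "(s * U u w)\<^sup>2 * exp (s * U u w) \<le> (s * U u w)\<^sup>2 * exp s"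
    using excess_le_1[of u w] assms by (intro mult_left_mono) (auto simp: mult_left_le)
  then have "p * ((s * U u w)\<^sup>2 * exp (s * U u w)) \<le> p * ((s * U u w)\<^sup>2 * exp s)"
    using p(1) by (rule mult_left_mono[OF _ less_imp_le])
  moreover have "rel_entropy p (p + U u w)
      \<ge> (s * U u w) * U u w - p * ((s * U u w)\<^sup>2 * exp (s * U u w))"
    using p U assms by (intro rel_entropy_add_ge) (auto intro: add_nonneg_nonneg less_imp_le)
  ultimately show "(U u w)\<^sup>2 * (s - p * s\<^sup>2 * exp s) \<le> rel_entropy p (p + U u w)"
    by (simp add: algebra_simps power2_eq_square)
qed

text \<open>For a small fixed \<open>l\<close> this makes the mean of \<open>U\<close> small
  compared with \<open>p\<close>.\<close>

lemma entropy_ge_mean: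
  assumes "l \<ge> 0"
  shows "l * avg V (\<lambda>u. avg V (\<lambda>w. U u w)) - p * (l\<^sup>2 * exp l)
     \<le> avg V (\<lambda>u. avg V (\<lambda>w. rel_entropy p (p + U u w)))"
proof -
  have "avg V (\<lambda>u. l * avg V (\<lambda>w. U u w) - p * (l\<^sup>2 * exp l))
     \<le> avg V (\<lambda>u. avg V (\<lambda>w. rel_entropy p (p + U u w)))"
    using row_entropy_ge[OF assms] by (intro avg_mono) auto
  then show ?thesis using V by (simp add: avg_diff avg_mult_left avg_const)
qed

text \<open>One multiplier for a whole row: a row of mean at least \<open>b\<close> costs about
  \<open>l * b\<close>, which limits the number of hubs.\<close>

lemma entropy_ge_hubs:
  assumes "l \<ge> 0" and B: "\<And>u. u \<in> B \<Longrightarrow> b \<le> avg V (U u)"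
  shows "avg V (\<lambda>u. if u \<in> B then 1 else 0) * (l * b - p * (l\<^sup>2 * exp l))
     \<le> avg V (\<lambda>u. avg V (\<lambda>w. rel_entropy p (p + U u w)))"
  unfolding avg_mult_right[symmetric]
proof (intro avg_mono)
  fix u
  have "l * b \<le> l * avg V (U u)" if "u \<in> B" using assms that by (intro mult_left_mono) auto
  then show "(if u \<in> B then 1 else 0) * (l * b - p * (l\<^sup>2 * exp l)) \<le> avg V (\<lambda>w. rel_entropy p (p + U u w))"
    using row_entropy_ge[OF assms(1), of u] row_entropy_nonneg[of u] by auto
qed

text \<open>The multiplier of a row is \<open>s\<close> times its mean \<open>d\<close>. As
  \<open>d\<close> is at most \<open>b\<close>, the exponential stays below
  \<open>exp (s * b)\<close>, so \<open>s\<close> may be of order \<open>ln (1 / p) / b\<close>;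
  this extra \<open>1 / b\<close> is what makes the mean square degree small.\<close>

lemma entropy_ge_low_degrees:
  assumes "s \<ge> 0" and B: "\<And>u. u \<in> V \<Longrightarrow> u \<notin> B \<Longrightarrow> avg V (U u) \<le> b"
  shows "avg V (\<lambda>u. (1 - (if u \<in> B then 1 else 0)) * (avg V (U u))\<^sup>2) * (s - p * s\<^sup>2 * exp (s * b))
     \<le> avg V (\<lambda>u. avg V (\<lambda>w. rel_entropy p (p + U u w)))"
  unfolding avg_mult_right[symmetric]
proof (intro avg_mono)
  fix u assume u: "u \<in> V"
  define d where "d = avg V (U u)"
  have d: "d \<ge> 0" unfolding d_def using U by (intro avg_nonneg) auto
  show "(1 - (if u \<in> B then 1 else 0)) * (avg V (U u))\<^sup>2 * (s - p * s\<^sup>2 * exp (s * b))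
      \<le> avg V (\<lambda>w. rel_entropy p (p + U u w))"
  proof (cases "u \<in> B")
    case False
    have "(s * d)\<^sup>2 * exp (s * d) \<le> (s * d)\<^sup>2 * exp (s * b)"
      using B[OF u False] assms by (intro mult_left_mono) (auto simp: d_def mult_left_mono)
    then have "p * ((s * d)\<^sup>2 * exp (s * d)) \<le> p * ((s * d)\<^sup>2 * exp (s * b))"
      using p(1) by (rule mult_left_mono[OF _ less_imp_le])
    then have "d\<^sup>2 * (s - p * s\<^sup>2 * exp (s * b)) \<le> (s * d) * d - p * ((s * d)\<^sup>2 * exp (s * d))"
      by (simp add: algebra_simps power2_eq_square)
    also have "\<dots> \<le> avg V (\<lambda>w. rel_entropy p (p + U u w))"
      using row_entropy_ge[of "s * d" u] assms d by (simp add: d_def)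
    finally show ?thesis using False by (simp add: d_def)
  qed (use row_entropy_nonneg in simp)
qed

text \<open>A binomial expansion in which all terms beyond the linear one are absorbed into the
  square; this is possible because \<open>p + U u w \<le> 1\<close>.\<close>

lemma avg_power_shift_le:
  assumes "r > 0"
  shows "avg V (\<lambda>u. avg V (\<lambda>w. (p + U u w) ^ r))
    \<le> p ^ r + real r * p ^ (r - 1) * avg V (\<lambda>u. avg V (\<lambda>w. U u w))
       + 2 ^ r * avg V (\<lambda>u. avg V (\<lambda>w. (U u w)\<^sup>2))"
proof -
  have "(p + x) ^ r \<le> p ^ r + real r * p ^ (r - 1) * x + 2 ^ r * x\<^sup>2" if x: "0 \<le> x" "p + x \<le> 1" for x
    using assms
  proof (induction r rule: nat_induct_non_zero)
    case 1
    then show ?case by simp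
  next
    case (Suc r)
    then obtain s where s: "r = Suc s" by (cases r) auto
    have "(p + x) ^ Suc r \<le> (p + x) * (p ^ r + real r * p ^ (r - 1) * x + 2 ^ r * x\<^sup>2)"
      using Suc p x by (auto intro!: mult_left_mono)
    also have "\<dots> = p ^ Suc r + real (Suc r) * p ^ r * x + x\<^sup>2 * (real r * p ^ (r - 1) + 2 ^ r * (p + x))"
      unfolding s by (simp add: algebra_simps power2_eq_square)
    also have "\<dots> \<le> p ^ Suc r + real (Suc r) * p ^ r * x + x\<^sup>2 * 2 ^ Suc r"
    proof -
      have "real r * p ^ (r - 1) \<le> real r * 1" using p by (intro mult_left_mono power_le_one) auto
      moreover have "real r \<le> 2 ^ r" by (simp add: less_imp_le)
      moreover have "2 ^ r * (p + x) \<le> 2 ^ r * 1" using x by (intro mult_left_mono) auto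
      ultimately have "real r * p ^ (r - 1) + 2 ^ r * (p + x) \<le> 2 ^ Suc r"
        unfolding power_Suc by linarith
      then show ?thesis by (intro add_left_mono mult_left_mono) auto
    qed
    finally show ?case by (simp add: mult.commute)
  qed
  then have "avg V (\<lambda>u. avg V (\<lambda>w. (p + U u w) ^ r))
    \<le> avg V (\<lambda>u. avg V (\<lambda>w. p ^ r + real r * p ^ (r - 1) * U u w + 2 ^ r * (U u w)\<^sup>2))"
    using U by (intro avg_mono) auto
  then show ?thesis using V by (simp add: avg_add avg_mult_left avg_const)
qed

end

section \<open>From a weighted graph to its excess over \<open>p\<close>\<close>

lemma sum_edges_symmetric:
  fixes f :: "nat \<Rightarrow> nat \<Rightarrow> real"
  assumes "finite I" "\<And>i j. f i j = f j i" "\<And>i. f i i = 0"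
  shows "(\<Sum>i\<in>I. \<Sum>j\<in>I. f i j) = 2 * (\<Sum>(i, j)\<in>edges I. f i j)"
  using assms(1)
proof (induction I rule: finite_induct)
  case (insert a I)
  have "(\<Sum>(i, j)\<in>(\<lambda>j. (min a j, max a j)) ` I. f i j) = (\<Sum>j\<in>I. f a j)"
    unfolding sum.reindex[OF inj_on_min_max] using assms(2)
    by (intro sum.cong refl) (simp add: min_def max_def)
  then have "(\<Sum>(i, j)\<in>edges (insert a I). f i j) = (\<Sum>(i, j)\<in>edges I. f i j) + (\<Sum>j\<in>I. f a j)"
    using insert.hyps by (simp add: edges_insert sum.union_disjoint edges_disjoint)
  then show ?case
    using insert assms(2)[of _ a] by (simp add: sum.distrib assms(3))
qed (simp add: edges_def)

lemma clique_edges_eq: "clique_edges k = edges {1..k}"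
  by (auto simp: clique_edges_def edges_def)

lemma hom_density_eq_avg:
  "hom_density k (clique_edges k) n G
    = avg ({1..k} \<rightarrow>\<^sub>E {1..n}) (\<lambda>x. \<Prod>(i, j)\<in>edges {1..k}. G (x i) (x j))"
  by (simp add: hom_density_def avg_def clique_edges_eq card_funcsetE)

text \<open>Raising entries below \<open>p\<close> to \<open>p\<close> can only lower the entropy,
  and the diagonal then contributes nothing. The factor 2 counts ordered pairs. \<open>U\<close> is
  0 outside the vertex set, where \<open>G\<close> is arbitrary.\<close>

lemma graph_entropy_ge_avg:
  fixes G :: "nat \<Rightarrow> nat \<Rightarrow> real"
  defines "U \<equiv> \<lambda>n p u w. if u \<in> {1..n} \<and> w \<in> {1..n} then max (G u w - p) 0 else 0"
  assumes G: "G \<in> weighted_graphs n" and p: "0 < p" "p < 1" and n: "n \<ge> 1"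
  shows "real n ^ 2 * avg {1..n} (\<lambda>u. avg {1..n} (\<lambda>w. rel_entropy p (p + U n p u w)))
    \<le> 2 * graph_entropy n p G"
proof -
  have Gd: "0 \<le> G u w" "G u w \<le> 1" "G u w = G w u" "G u u = 0" if "u \<in> {1..n}" "w \<in> {1..n}" for u w
    using G that by (auto simp: weighted_graphs_def)
  define f where "f u w = rel_entropy p (p + U n p u w)" for u w
  have sym: "U n p u w = U n p w u" for u w using Gd(3)[of u w] by (auto simp: U_def)
  have "U n p u u = 0" for u using Gd(4)[of u u] p by (auto simp: U_def)
  then have diag: "f u u = 0" for u using p by (simp add: f_def rel_entropy_self)
  have "real n ^ 2 * avg {1..n} (\<lambda>u. avg {1..n} (\<lambda>w. f u w)) = (\<Sum>u\<in>{1..n}. \<Sum>w\<in>{1..n}. f u w)"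
    using n by (simp add: avg_def sum_divide_distrib[symmetric] power2_eq_square)
  also have "\<dots> = 2 * (\<Sum>(u, w)\<in>edges {1..n}. f u w)"
    using diag sym by (intro sum_edges_symmetric) (auto simp: f_def)
  also have "(\<Sum>(u, w)\<in>edges {1..n}. f u w) \<le> (\<Sum>(u, w)\<in>edges {1..n}. rel_entropy p (G u w))"
  proof (intro sum_mono, clarify)
    fix u w assume "(u, w) \<in> edges {1..n}"
    then have uw: "u \<in> {1..n}" "w \<in> {1..n}" by (auto simp: edges_def)
    show "f u w \<le> rel_entropy p (G u w)"
    proof (cases "G u w \<le> p")
      case True
      then show ?thesis
        using uw Gd[OF uw] p by (simp add: f_def U_def rel_entropy_self rel_entropy_nonneg max_def)
    qed (use uw in \<open>auto simp: f_def U_def max_def\<close>)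
  qed
  also have "(\<Sum>(u, w)\<in>edges {1..n}. rel_entropy p (G u w)) = graph_entropy n p G"
    by (simp only: graph_entropy_def clique_edges_def[symmetric] clique_edges_eq)
  finally show ?thesis by (simp add: f_def)
qed

text \<open>A pair with exactly one end in \<open>B\<close> is counted once by the two indicator
  terms. A pair inside \<open>B\<close> is counted twice, and subtracting 1 corrects for this as
  \<open>U\<close> is at most 1.\<close>

lemma square_split_hubs:
  fixes U :: "'a \<Rightarrow> 'a \<Rightarrow> real"
  assumes "\<And>u w. 0 \<le> U u w" "\<And>u w. U u w \<le> 1" "\<And>u w. U u w = U w u"
  shows "avg V (\<lambda>u. avg V (\<lambda>w. (if u \<in> B \<or> w \<in> B then 0 else U u w)\<^sup>2))
      + 2 * avg V (\<lambda>u. (if u \<in> B then 1 else 0) * avg V (\<lambda>w. (U u w)\<^sup>2))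
      - (avg V (\<lambda>u. if u \<in> B then 1 else 0))\<^sup>2
    \<le> avg V (\<lambda>u. avg V (\<lambda>w. (U u w)\<^sup>2))"
proof -
  define ind where "ind u = (if u \<in> B then 1 else 0 :: real)" for u
  have "(if u \<in> B \<or> w \<in> B then 0 else U u w)\<^sup>2 + ind u * (U u w)\<^sup>2 + ind w * (U u w)\<^sup>2 - ind u * ind w
      \<le> (U u w)\<^sup>2" for u w
    using assms(1,2)[of u w] by (auto simp: ind_def power_le_one)
  then have "avg V (\<lambda>u. avg V (\<lambda>w. (if u \<in> B \<or> w \<in> B then 0 else U u w)\<^sup>2 + ind u * (U u w)\<^sup>2
      + ind w * (U u w)\<^sup>2 - ind u * ind w)) \<le> avg V (\<lambda>u. avg V (\<lambda>w. (U u w)\<^sup>2))"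
    by (intro avg_mono)
  moreover have "avg V (\<lambda>u. avg V (\<lambda>w. ind w * (U u w)\<^sup>2)) = avg V (\<lambda>u. ind u * avg V (\<lambda>w. (U u w)\<^sup>2))"
  proof -
    have "avg V (\<lambda>u. avg V (\<lambda>w. ind w * (U u w)\<^sup>2)) = avg V (\<lambda>w. avg V (\<lambda>u. ind w * (U u w)\<^sup>2))"
      by (rule avg_swap)
    then show ?thesis using assms(3) by (simp add: avg_mult_left)
  qed
  moreover have "avg V (\<lambda>u. avg V (\<lambda>w. ind u * ind w)) = (avg V ind)\<^sup>2"
    by (simp add: avg_mult_left avg_mult_right power2_eq_square)
  ultimately show ?thesis by (simp add: avg_add avg_diff avg_mult_left ind_def[abs_def])
qed

text \<open>The witnesses \<phi> and \<theta> are the square masses of the excess away from the hubs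
  and at the hubs, in units of \<open>p ^ N\<close>. The threshold on \<open>p\<close> does not
  depend on \<open>n\<close> or \<open>G\<close>, so that \<open>p\<close> may later vary with
  \<open>n\<close>.\<close>

lemma clique_entropy_structure:
  fixes \<delta> \<epsilon> C0 :: real
  assumes N: "N \<ge> 2" and \<epsilon>: "\<epsilon> > 0" and C0: "C0 > 0"
  shows "\<exists>\<beta>>0. eventually (\<lambda>p. \<forall>n\<ge>1. \<forall>G\<in>weighted_graphs n.
     (1 + \<delta>) * p ^ card (clique_edges (Suc N)) \<le> hom_density (Suc N) (clique_edges (Suc N)) n G \<longrightarrow>
     graph_entropy n p G \<le> C0 * (real n ^ 2 * p ^ N * ln (1 / p)) \<longrightarrow>
     (\<exists>\<phi>\<ge>0. \<exists>\<theta>\<ge>0. \<delta> - \<epsilon> \<le> \<phi> powr (real (Suc N) / 2) + real (Suc N) * \<theta>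
        \<and> (\<phi> / 2 + \<theta> - \<epsilon>) * (real n ^ 2 * p ^ N * ln (1 / p)) \<le> graph_entropy n p G
        \<and> (\<beta> * real n * p ^ N < 1 \<longrightarrow> \<theta> = 0))) (at_right 0)"
proof -
  define I where "I = {1..Suc N}"
  define e where "e = card (edges I)"
  have I: "finite I" "card I = Suc N" by (auto simp: I_def)
  have e2: "2 * e = Suc N * N" using card_edges[OF I(1)] I by (simp add: e_def)
  have eN: "e \<ge> N" using e2 N by (cases N) auto
  define C where "C = max 1 (4 * C0)"
  have C: "C \<ge> 1" "C \<ge> 4 * C0" by (auto simp: C_def)
  define M where "M = 2 ^ e * C ^ e"
  have M: "M > 0" using C by (simp add: M_def)
  \<comment> \<open>The mixed subgraphs cost \<open>M * \<gamma> powr (1 / real N)\<close> with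
    \<gamma> proportional to \<open>b\<close>; \<open>b\<close> is solved from the requirement that
    this be \<open>\<epsilon> / 2\<close>.\<close>
  define b where "b = (\<epsilon> / 2 / M) ^ N / (8 * C0)"
  have b: "b > 0" using \<epsilon> M C0 by (simp add: b_def)
  define \<gamma> where "\<gamma> = 8 * C0 * b"
  have \<gamma>: "\<gamma> > 0" using b C0 by (simp add: \<gamma>_def)
  have M\<gamma>: "M * \<gamma> powr (1 / real N) = \<epsilon> / 2"
    using C0 M \<epsilon> N by (simp add: \<gamma>_def b_def powr_inverse_power del: power_divide)
  \<comment> \<open>The hub bound reads
    \<open>avg V ind * (b * L / 4) \<le> 2 * C0 * p ^ N * L\<close>.\<close>
  define \<beta> where "\<beta> = 8 * C0 / b"
  have \<beta>: "\<beta> > 0" using b C0 by (simp add: \<beta>_def)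
  \<comment> \<open>\<open>r\<close> is the fraction of \<open>ln (1 / p)\<close> given up in the
    square bound: \<open>r \<le> 1/4\<close> gives \<open>Z \<le> 4 * C0 * p ^ N\<close>, and the
    loss \<open>2 * r * Z\<close> is then at most \<open>\<epsilon> * p ^ N\<close>.\<close>
  define r where "r = min (1/4) (\<epsilon> / (8 * C0))"
  have r: "0 < r" "r < 1" "r \<le> 1/4" "8 * r * C0 \<le> \<epsilon>"
    using \<epsilon> C0 by (auto simp: r_def min_def field_simps)
  obtain \<kappa> where \<kappa>: "\<kappa> > 0" "real (Suc N) * (\<beta> * ((1 + \<kappa>) ^ e - 1)) < \<epsilon> / 4"
  proof -
    have "((\<lambda>\<kappa>. real (Suc N) * (\<beta> * ((1 + \<kappa>) ^ e - 1))) \<longlongrightarrow> real (Suc N) * (\<beta> * ((1 + 0) ^ e - 1))) (at_right 0)"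
      by (intro tendsto_intros)
    then have "eventually (\<lambda>\<kappa>. real (Suc N) * (\<beta> * ((1 + \<kappa>) ^ e - 1)) < \<epsilon> / 4) (at_right 0)"
      using \<epsilon> by (intro order_tendstoD(2)) auto
    then have "eventually (\<lambda>\<kappa>. \<kappa> > 0 \<and> real (Suc N) * (\<beta> * ((1 + \<kappa>) ^ e - 1)) < \<epsilon> / 4) (at_right 0)"
      using eventually_at_right_less[of 0] by eventually_elim auto
    then show ?thesis using that eventually_happens'[OF trivial_limit_at_right_real] by blast
  qed
  define m where "m = N - 1"
  have m: "m > 0" "N = Suc m" using N by (auto simp: m_def)
  \<comment> \<open>One half of \<kappa> pays for the linear term of the moment expansion, the other
    half for its square term.\<close>
  define \<eta> where "\<eta> = \<kappa> / (2 * real m)"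
  have \<eta>: "\<eta> > 0" "real m * \<eta> = \<kappa> / 2" using \<kappa> m by (auto simp: \<eta>_def)
  define l where "l = min 1 (\<eta> / (2 * exp 1))"
  have l: "l > 0" "l * exp l \<le> \<eta> / 2"
  proof -
    show "l > 0" using \<eta> by (simp add: l_def)
    have "l * exp l \<le> (\<eta> / (2 * exp 1)) * exp 1"
      using \<eta> by (intro mult_mono) (auto simp: l_def)
    then show "l * exp l \<le> \<eta> / 2" by simp
  qed
  \<comment> \<open>The multipliers \<open>(1-r)*L\<close>, \<open>L/2\<close> and
    \<open>L/(2*b)\<close> with \<open>L = ln (1/p)\<close> leave errors of order
    \<open>p powr r\<close> or \<open>sqrt p\<close> up to powers of \<open>L\<close>, while the
    main terms grow like \<open>L\<close>.\<close>
  have ev: "eventually (\<lambda>p::real. 0 < p \<and> p < 1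
      \<and> (1-r)*ln(1/p) - p*((1-r)*ln (1/p))\<^sup>2*exp((1-r)*ln(1/p)) \<ge> (1-2*r)*ln(1/p)
      \<and> (ln (1/p)/2)*b - p*((ln (1/p)/2)\<^sup>2*exp(ln (1/p)/2)) \<ge> b * ln (1/p)/4
      \<and> (ln (1/p)/(2*b)) - p*(ln (1/p)/(2*b))\<^sup>2*exp(ln (1/p)/(2*b)*b) \<ge> ln (1/p)/(4*b)
      \<and> (2 * C0) * p * ln (1/p) \<le> \<eta> * l / 2
      \<and> (2^m * C) * p \<le> \<kappa> / 2
      \<and> (real (Suc N) * \<beta> * 3) * p \<le> \<epsilon> / 4
      \<and> \<beta>\<^sup>2 * p \<le> \<epsilon>) (at_right 0)"
  proof (intro eventually_conj)
    show "eventually (\<lambda>p::real. 0 < p) (at_right 0)" by real_asymp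
    show "eventually (\<lambda>p::real. p < 1) (at_right 0)" by real_asymp
    show "eventually (\<lambda>p::real. (1-r)*ln(1/p) - p*((1-r)*ln (1/p))\<^sup>2*exp((1-r)*ln(1/p)) \<ge> (1-2*r)*ln(1/p)) (at_right 0)"
      using r(1,2) by real_asymp
    show "eventually (\<lambda>p::real. (ln (1/p)/2)*b - p*((ln (1/p)/2)\<^sup>2*exp(ln (1/p)/2)) \<ge> b * ln (1/p)/4) (at_right 0)"
      using b by real_asymp
    show "eventually (\<lambda>p::real. (ln (1/p)/(2*b)) - p*(ln (1/p)/(2*b))\<^sup>2*exp(ln (1/p)/(2*b)*b) \<ge> ln (1/p)/(4*b)) (at_right 0)"
      using b by real_asymp
    have x: "\<eta> * l / 2 > 0" using \<eta> l by simp
    have small: "eventually (\<lambda>p::real. K * p \<le> x) (at_right 0)" if "x > 0" for K x :: real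
      using that by real_asymp
    have "eventually (\<lambda>p::real. K * p * ln (1/p) \<le> x) (at_right 0)" if "x > 0" for K x :: real
      using that by real_asymp
    from this[OF x] show "eventually (\<lambda>p::real. (2 * C0) * p * ln (1/p) \<le> \<eta> * l / 2) (at_right 0)" .
    show "eventually (\<lambda>p::real. (2^m * C) * p \<le> \<kappa> / 2) (at_right 0)" using \<kappa> by (intro small) auto
    show "eventually (\<lambda>p::real. (real (Suc N) * \<beta> * 3) * p \<le> \<epsilon> / 4) (at_right 0)" using \<epsilon> by (intro small) auto
    show "eventually (\<lambda>p::real. \<beta>\<^sup>2 * p \<le> \<epsilon>) (at_right 0)" using \<epsilon> by (intro small) auto
  qed
  show ?thesis
  proof (intro exI conjI, rule \<beta>, use ev in eventually_elim, intro allI impI ballI)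
    fix p n G
    assume P: "0 < p \<and> p < 1
      \<and> (1-r)*ln(1/p) - p*((1-r)*ln (1/p))\<^sup>2*exp((1-r)*ln(1/p)) \<ge> (1-2*r)*ln(1/p)
      \<and> (ln (1/p)/2)*b - p*((ln (1/p)/2)\<^sup>2*exp(ln (1/p)/2)) \<ge> b * ln (1/p)/4
      \<and> (ln (1/p)/(2*b)) - p*(ln (1/p)/(2*b))\<^sup>2*exp(ln (1/p)/(2*b)*b) \<ge> ln (1/p)/(4*b)
      \<and> (2 * C0) * p * ln (1/p) \<le> \<eta> * l / 2
      \<and> (2^m * C) * p \<le> \<kappa> / 2
      \<and> (real (Suc N) * \<beta> * 3) * p \<le> \<epsilon> / 4
      \<and> \<beta>\<^sup>2 * p \<le> \<epsilon>"
    assume n: "(1::nat) \<le> n" and G: "G \<in> weighted_graphs n"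
      and dens: "(1 + \<delta>) * p ^ card (clique_edges (Suc N)) \<le> hom_density (Suc N) (clique_edges (Suc N)) n G"
      and ent: "graph_entropy n p G \<le> C0 * (real n ^ 2 * p ^ N * ln (1 / p))"
    define L where "L = ln (1 / p)"
    have p: "0 < p" "p < 1" using P by auto
    have L: "L > 0" using p by (simp add: L_def)
    have pN: "p ^ N > 0" using p by simp
    define V where "V = {1..n}"
    have V: "finite V" "V \<noteq> {}" and cardV: "card V = n" using n by (auto simp: V_def)
    define U where "U u w = (if u \<in> V \<and> w \<in> V then max (G u w - p) 0 else 0)" for u w
    have Gd: "0 \<le> G u w" "G u w \<le> 1" "G u w = G w u" if "u \<in> V" "w \<in> V" for u w
      using G that by (auto simp: weighted_graphs_def V_def)
    have U: "0 \<le> U u w" "p + U u w \<le> 1" "U u w = U w u" for u w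
      using Gd[of u w] p by (auto simp: U_def)
    have U1: "U u w \<le> 1" for u w using U(2)[of u w] p by linarith
    define E where "E = avg V (\<lambda>u. avg V (\<lambda>w. rel_entropy p (p + U u w)))"
    have E: "real n ^ 2 * E \<le> 2 * graph_entropy n p G"
      using graph_entropy_ge_avg[OF G p n] by (simp add: E_def U_def V_def)
    have E_le: "E \<le> 2 * C0 * p ^ N * L"
    proof -
      have "real n ^ 2 * E \<le> real n ^ 2 * (2 * C0 * p ^ N * L)" using E ent by (simp add: L_def algebra_simps)
      then show ?thesis using n by (simp add: mult_le_cancel_left)
    qed
    define B where "B = {u \<in> V. b \<le> avg V (U u)}"
    define ind where "ind u = (if u \<in> B then 1 else 0 :: real)" for u
    define Z where "Z = avg V (\<lambda>u. avg V (\<lambda>w. (U u w)\<^sup>2))"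
    define Z' where "Z' = avg V (\<lambda>u. avg V (\<lambda>w. (if u \<in> B \<or> w \<in> B then 0 else U u w)\<^sup>2))"
    define T where "T = avg V (\<lambda>u. ind u * avg V (\<lambda>w. (U u w)\<^sup>2))"
    have nonneg: "Z \<ge> 0" "Z' \<ge> 0" "T \<ge> 0"
      by (auto simp: Z_def Z'_def T_def ind_def intro!: avg_nonneg mult_nonneg_nonneg)
    have ZE: "Z * ((1 - 2 * r) * L) \<le> E"
    proof -
      have "Z * ((1 - 2 * r) * L) \<le> Z * ((1-r)*L - p*((1-r)*L)\<^sup>2*exp((1-r)*L))"
        using P nonneg by (intro mult_left_mono) (auto simp: L_def)
      also have "\<dots> \<le> E"
        unfolding Z_def E_def using r L by (intro entropy_ge_square V U p) auto
      finally show ?thesis .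
    qed
    have Z_le: "Z \<le> 4 * C0 * p ^ N"
    proof -
      have "Z * (1/2 * L) \<le> Z * ((1 - 2 * r) * L)"
        using r L nonneg by (intro mult_left_mono mult_right_mono) auto
      also have "\<dots> \<le> 2 * C0 * p ^ N * L" using ZE E_le by simp
      finally show ?thesis using L by (simp add: field_simps)
    qed
    have ind_le: "avg V ind \<le> \<beta> * p ^ N"
    proof -
      have "avg V ind \<ge> 0" by (auto simp: ind_def intro!: avg_nonneg)
      then have "avg V ind * (b * L / 4) \<le> avg V ind * ((L/2)*b - p*((L/2)\<^sup>2*exp(L/2)))"
        using P by (intro mult_left_mono) (auto simp: L_def)
      also have "\<dots> \<le> E"
        unfolding ind_def E_def using L by (intro entropy_ge_hubs V U p) (auto simp: B_def)
      also have "\<dots> \<le> 2 * C0 * p ^ N * L" by (rule E_le)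
      finally show ?thesis using L b by (simp add: \<beta>_def field_simps)
    qed
    have low_deg: "avg V (\<lambda>w. (1 - ind w) * (avg V (\<lambda>u. U u w))\<^sup>2) \<le> \<gamma> * p ^ N"
    proof -
      define D where "D = avg V (\<lambda>u. (1 - ind u) * (avg V (U u))\<^sup>2)"
      have "D \<ge> 0" by (auto simp: D_def ind_def intro!: avg_nonneg)
      then have "D * (L / (4 * b)) \<le> D * (L/(2*b) - p*(L/(2*b))\<^sup>2*exp(L/(2*b)*b))"
        using P by (intro mult_left_mono) (auto simp: L_def)
      also have "\<dots> \<le> E"
        unfolding D_def ind_def E_def using L b
        by (intro entropy_ge_low_degrees V U p) (auto simp: B_def)
      also have "\<dots> \<le> 2 * C0 * p ^ N * L" by (rule E_le)
      finally have "D \<le> \<gamma> * p ^ N" using L b by (simp add: \<gamma>_def field_simps)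
      moreover have "(\<lambda>u. U u w) = U w" for w using U(3) by auto
      ultimately show ?thesis by (simp add: D_def)
    qed
    have mean: "avg V (\<lambda>u. avg V (\<lambda>w. U u w)) \<le> \<eta> * p"
    proof -
      have "l * avg V (\<lambda>u. avg V (\<lambda>w. U u w)) - p * (l\<^sup>2 * exp l) \<le> E"
        unfolding E_def using l by (intro entropy_ge_mean V U p) auto
      then have "l * avg V (\<lambda>u. avg V (\<lambda>w. U u w)) \<le> E + p * (l\<^sup>2 * exp l)" by simp
      also have "E \<le> (2 * C0 * p * L) * p"
      proof -
        \<comment> \<open>Since \<open>N\<close> is at least 2, the entropy is \<open>p\<close>
          times a quantity of order \<open>p * L\<close>, which tends to 0.\<close>
        have "p ^ N \<le> p ^ 2" using N p by (intro power_decreasing) auto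
        then have "2 * C0 * L * p ^ N \<le> 2 * C0 * L * p ^ 2" using C0 L by (intro mult_left_mono) auto
        then show ?thesis using E_le by (simp add: power2_eq_square algebra_simps)
      qed
      also have "\<dots> \<le> (\<eta> * l / 2) * p" using P p by (intro mult_right_mono) (auto simp: L_def)
      also have "p * (l\<^sup>2 * exp l) = (l * p) * (l * exp l)" by (simp add: power2_eq_square)
      also have "\<dots> \<le> (l * p) * (\<eta> / 2)" using l p by (intro mult_left_mono) auto
      finally have "l * avg V (\<lambda>u. avg V (\<lambda>w. U u w)) \<le> l * (\<eta> * p)" by (simp add: algebra_simps)
      then show ?thesis using l by simp
    qed
    have low: "avg V (\<lambda>u. avg V (\<lambda>w. (p + U u w) ^ (N - 1))) \<le> (p * (1 + \<kappa>)) ^ (N - 1)"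
    proof -
      have "avg V (\<lambda>u. avg V (\<lambda>w. (p + U u w) ^ m))
          \<le> p ^ m + real m * p ^ (m - 1) * avg V (\<lambda>u. avg V (\<lambda>w. U u w)) + 2 ^ m * Z"
        unfolding Z_def by (intro avg_power_shift_le V U p m(1))
      also have "\<dots> \<le> p ^ m + real m * p ^ (m - 1) * (\<eta> * p) + 2 ^ m * (C * p ^ N)"
        using mean Z_le C(2) pN p
        by (intro add_mono mult_left_mono order.trans[OF Z_le] mult_right_mono) auto
      also have "\<dots> = p ^ m * (1 + real m * \<eta> + (2 ^ m * C) * p)"
        using m by (cases m) (auto simp: algebra_simps)
      also have "\<dots> \<le> p ^ m * (1 + \<kappa>)"
        using P \<eta> p by (intro mult_left_mono) auto
      also have "\<dots> \<le> p ^ m * (1 + \<kappa>) ^ m"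
        using \<kappa> p m self_le_power[of "1 + \<kappa>" m] by (intro mult_left_mono) auto
      finally show ?thesis by (simp add: m_def power_mult_distrib)
    qed
    define X where "X = Z' powr (real e / real N)"
    have "(1 + \<delta>) * p ^ e \<le> avg (I \<rightarrow>\<^sub>E V) (\<lambda>x. \<Prod>(i, j)\<in>edges I. G (x i) (x j))"
      using dens unfolding hom_density_eq_avg unfolding clique_edges_eq e_def I_def V_def .
    also have "\<dots> \<le> avg (I \<rightarrow>\<^sub>E V) (\<lambda>x. \<Prod>(i, j)\<in>edges I. p + U (x i) (x j))"
    proof (intro avg_mono prod_mono, clarify)
      fix x i j assume x: "x \<in> I \<rightarrow>\<^sub>E V" and ij: "(i, j) \<in> edges I"
      then have "x i \<in> V" "x j \<in> V" by (auto simp: edges_def PiE_iff)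
      then show "0 \<le> G (x i) (x j) \<and> G (x i) (x j) \<le> p + U (x i) (x j)"
        using Gd by (auto simp: U_def)
    qed
    also have "\<dots> \<le> p ^ e + X + 2 ^ e * (C ^ e * \<gamma> powr (1 / real N) * p ^ e)
        + real (Suc N) * (p ^ (e - N) * (T + \<beta> * p ^ N * (3 * p + ((1 + \<kappa>) ^ e - 1))))"
      unfolding e_def X_def T_def Z'_def ind_def
      using low_deg ind_le low Z_le C pN \<gamma> \<kappa> \<beta>
      by (intro clique_density_upper[OF I N V U p(1)])
        (auto simp: ind_def[abs_def] Z_def intro: order.trans mult_right_mono)
    finally have main: "(1 + \<delta>) * p ^ e \<le> p ^ e + X + 2 ^ e * (C ^ e * \<gamma> powr (1 / real N) * p ^ e)
        + real (Suc N) * (p ^ (e - N) * (T + \<beta> * p ^ N * (3 * p + ((1 + \<kappa>) ^ e - 1))))" .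
    define \<phi> where "\<phi> = Z' / p ^ N"
    define \<theta> where "\<theta> = T / p ^ N"
    have \<phi>: "\<phi> \<ge> 0" "Z' = \<phi> * p ^ N" and \<theta>: "\<theta> \<ge> 0" "T = \<theta> * p ^ N"
      using nonneg p by (auto simp: \<phi>_def \<theta>_def)
    have X: "X = \<phi> powr (real (Suc N) / 2) * p ^ e"
    proof -
      \<comment> \<open>The clique has \<open>e = N * (N + 1) / 2\<close> edges, so a square mass of
        order \<open>p ^ N\<close> contributes at the scale \<open>p ^ e\<close>.\<close>
      have q: "real e / real N = real (Suc N) / 2"
        using arg_cong[OF e2, of real] N by (simp add: field_simps)
      have "(p ^ N) powr (real e / real N) = p ^ e"
        using p N by (simp add: powr_realpow[symmetric] powr_powr)
      then have "X = \<phi> powr (real e / real N) * p ^ e" using \<phi> p by (simp add: X_def powr_mult)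
      then show ?thesis by (simp only: q)
    qed
    have "real (Suc N) * (p ^ (e - N) * (T + \<beta> * p ^ N * (3 * p + ((1 + \<kappa>) ^ e - 1))))
        = real (Suc N) * (\<theta> + \<beta> * (3 * p + ((1 + \<kappa>) ^ e - 1))) * (p ^ (e - N) * p ^ N)"
      unfolding \<theta>(2) by (simp add: algebra_simps)
    also have "p ^ (e - N) * p ^ N = p ^ e" using eN by (simp add: power_add[symmetric])
    finally have "(1 + \<delta>) * p ^ e \<le> (1 + \<phi> powr (real (Suc N) / 2) + M * \<gamma> powr (1 / real N)
        + real (Suc N) * (\<theta> + \<beta> * (3 * p + ((1 + \<kappa>) ^ e - 1)))) * p ^ e"
      using main X by (simp add: M_def algebra_simps)
    then have "1 + \<delta> \<le> 1 + \<phi> powr (real (Suc N) / 2) + M * \<gamma> powr (1 / real N)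
        + real (Suc N) * (\<theta> + \<beta> * (3 * p + ((1 + \<kappa>) ^ e - 1)))"
      using p by (simp add: mult_le_cancel_right)
    then have "\<delta> \<le> \<phi> powr (real (Suc N) / 2) + \<epsilon> / 2 + real (Suc N) * \<theta>
        + (real (Suc N) * \<beta> * 3) * p + real (Suc N) * (\<beta> * ((1 + \<kappa>) ^ e - 1))"
      unfolding M\<gamma> by (simp add: algebra_simps)
    then have 1: "\<delta> - \<epsilon> \<le> \<phi> powr (real (Suc N) / 2) + real (Suc N) * \<theta>"
      using P \<kappa>(2) by linarith
    have 2: "(\<phi> / 2 + \<theta> - \<epsilon>) * (real n ^ 2 * p ^ N * ln (1 / p)) \<le> graph_entropy n p G"
    proof -
      \<comment> \<open>Pairs of hubs have density of order \<open>p ^ (2 * N)\<close>, which is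
        negligible against \<open>p ^ N\<close>.\<close>
      have "(avg V ind)\<^sup>2 \<le> (\<beta> * p ^ N)\<^sup>2"
        using ind_le by (intro power_mono avg_nonneg) (auto simp: ind_def)
      also have "\<dots> = (\<beta>\<^sup>2 * p ^ N) * p ^ N" by (simp add: power2_eq_square)
      also have "\<dots> \<le> (\<beta>\<^sup>2 * p ^ 1) * p ^ N"
        using p N by (intro mult_left_mono mult_right_mono power_decreasing) auto
      also have "\<dots> \<le> \<epsilon> * p ^ N" using P p by (intro mult_right_mono) auto
      finally have sq: "(avg V ind)\<^sup>2 \<le> \<epsilon> * p ^ N" .
      have "Z' + 2 * T - (avg V ind)\<^sup>2 \<le> Z"
        using square_split_hubs[of U V B] U U1 by (simp add: Z'_def T_def Z_def ind_def[abs_def])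
      then have Z_ge: "(\<phi> + 2 * \<theta> - \<epsilon>) * p ^ N \<le> Z" using sq \<phi> \<theta> by (simp add: algebra_simps)
      have "2 * r * Z \<le> 2 * r * (4 * C0 * p ^ N)" using Z_le r by (intro mult_left_mono) auto
      also have "\<dots> \<le> \<epsilon> * p ^ N" using r pN by (simp add: algebra_simps)
      finally have "(\<phi> + 2 * \<theta> - 2 * \<epsilon>) * p ^ N \<le> Z * (1 - 2 * r)" using Z_ge by (simp add: algebra_simps)
      then have "(\<phi> + 2 * \<theta> - 2 * \<epsilon>) * p ^ N * L \<le> Z * (1 - 2 * r) * L" using L by (intro mult_right_mono) auto
      also have "\<dots> \<le> E" using ZE by (simp add: algebra_simps)
      finally have "real n ^ 2 * ((\<phi> + 2 * \<theta> - 2 * \<epsilon>) * p ^ N * L) \<le> real n ^ 2 * E"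
        by (intro mult_left_mono) auto
      then have "real n ^ 2 * ((\<phi> + 2 * \<theta> - 2 * \<epsilon>) * p ^ N * L) \<le> 2 * graph_entropy n p G" using E by linarith
      then show ?thesis by (simp add: L_def[symmetric] algebra_simps)
    qed
    have 3: "\<theta> = 0" if "\<beta> * real n * p ^ N < 1"
    proof -
      \<comment> \<open>The number of hubs is an integer bounded by
        \<open>\<beta> * real n * p ^ N\<close>, hence 0.\<close>
      have "V \<inter> B = {}"
      proof (rule ccontr)
        assume "V \<inter> B \<noteq> {}"
        then obtain u where "u \<in> V" "u \<in> B" by auto
        then have "1 \<le> sum ind V" using V member_le_sum[of u V ind] by (auto simp: ind_def)
        then have "1 \<le> real n * avg V ind" using n cardV by (simp add: avg_def)
        also have "\<dots> \<le> real n * (\<beta> * p ^ N)" using ind_le by (intro mult_left_mono) auto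
        finally show False using that by (simp add: mult_ac)
      qed
      then have "T = avg V (\<lambda>u. 0)" unfolding T_def by (intro avg_cong) (auto simp: ind_def)
      then show ?thesis using V by (simp add: \<theta>_def avg_const)
    qed
    show "\<exists>\<phi>\<ge>0. \<exists>\<theta>\<ge>0. \<delta> - \<epsilon> \<le> \<phi> powr (real (Suc N) / 2) + real (Suc N) * \<theta>
        \<and> (\<phi> / 2 + \<theta> - \<epsilon>) * (real n ^ 2 * p ^ N * ln (1 / p)) \<le> graph_entropy n p G
        \<and> (\<beta> * real n * p ^ N < 1 \<longrightarrow> \<theta> = 0)"
      using \<phi>(1) \<theta>(1) 1 2 3 by blast
  qed
qed

section \<open>Planted cliques and hubs\<close>

text \<open>With a zero diagonal, a map that is not injective has clique weight 0, so only these
  maps matter.\<close>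

definition injections :: "'i set \<Rightarrow> 'a set \<Rightarrow> ('i \<Rightarrow> 'a) set" where
  "injections I V = {x \<in> I \<rightarrow>\<^sub>E V. inj_on x I}"

lemma finite_injections: "finite I \<Longrightarrow> finite V \<Longrightarrow> finite (injections I V)"
  by (simp add: injections_def finite_funcset)

lemma injections_insert:
  assumes "a \<notin> I"
  shows "injections (insert a I) V = (\<lambda>(x, y). x(a := y)) ` (SIGMA x:injections I V. V - x ` I)"
proof
  show "injections (insert a I) V \<subseteq> (\<lambda>(x, y). x(a := y)) ` (SIGMA x:injections I V. V - x ` I)"
  proof
    fix z assume z: "z \<in> injections (insert a I) V"
    then have P: "z \<in> insert a I \<rightarrow>\<^sub>E V" and inj: "inj_on z (insert a I)" by (auto simp: injections_def)
    have "z(a := undefined) \<in> I \<rightarrow>\<^sub>E V"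
      using P assms by (auto simp: PiE_iff extensional_def)
    moreover have "inj_on (z(a := undefined)) I"
      using inj assms by (auto simp: inj_on_def)
    moreover have "z a \<in> V - (z(a := undefined)) ` I"
      using P inj assms by (auto simp: PiE_iff inj_on_def)
    ultimately show "z \<in> (\<lambda>(x, y). x(a := y)) ` (SIGMA x:injections I V. V - x ` I)"
      by (intro image_eqI[of _ _ "(z(a := undefined), z a)"]) (auto simp: injections_def)
  qed
  show "(\<lambda>(x, y). x(a := y)) ` (SIGMA x:injections I V. V - x ` I) \<subseteq> injections (insert a I) V"
  proof clarify
    fix x y assume x: "x \<in> injections I V" and y: "y \<in> V" "y \<notin> x ` I"
    have "inj_on (x(a := y)) I" using x y by (intro inj_on_fun_updI) (auto simp: injections_def)
    moreover have "(x(a := y)) ` I = x ` I" using assms by (auto simp: image_iff)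
    ultimately have "inj_on (x(a := y)) (insert a I)" using y by (auto simp: inj_on_insert)
    then show "x(a := y) \<in> injections (insert a I) V"
      using x y by (auto simp: injections_def PiE_iff extensional_def)
  qed
qed

lemma inj_on_fun_upd_Sigma:
  assumes "a \<notin> I" "A \<subseteq> I \<rightarrow>\<^sub>E V"
  shows "inj_on (\<lambda>(x, y). x(a := y)) (Sigma A B)"
proof (rule inj_onI, clarsimp)
  fix x x' y y' assume x: "x \<in> A" "x' \<in> A" and eq: "x(a := y) = x'(a := y')"
  have "x a = undefined" "x' a = undefined" using x assms by (auto simp: PiE_iff extensional_def)
  then have "x = x'" using eq by (metis fun_upd_triv fun_upd_upd)
  moreover have "y = y'" using fun_cong[OF eq, of a] by simp
  ultimately show "x = x' \<and> y = y'" by simp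
qed

text \<open>Each of the \<open>card I\<close> successive choices still has at least
  \<open>card V - card I\<close> options.\<close>

lemma card_injections_ge:
  assumes "finite I" "finite V" "card I \<le> card V"
  shows "(real (card V) - real (card I)) ^ card I \<le> real (card (injections I V))"
  using assms(1,3)
proof (induction I rule: finite_induct)
  case empty
  then show ?case by (simp add: injections_def)
next
  case (insert a I)
  have "card (injections (insert a I) V) = (\<Sum>x\<in>injections I V. card (V - x ` I))"
  proof -
    have "injections I V \<subseteq> I \<rightarrow>\<^sub>E V" by (auto simp: injections_def)
    from card_image[OF inj_on_fun_upd_Sigma[OF insert.hyps(2) this]] show ?thesis
      unfolding injections_insert[OF insert.hyps(2)]
      using finite_injections[OF insert.hyps(1) assms(2)] assms(2) by simp
  qed
  also have "\<dots> = (\<Sum>x\<in>injections I V. card V - card I)"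
  proof (intro sum.cong refl)
    fix x assume "x \<in> injections I V"
    then have "x ` I \<subseteq> V" "card (x ` I) = card I" by (auto simp: injections_def card_image)
    then show "card (V - x ` I) = card V - card I"
      using insert.hyps assms(2) by (simp add: card_Diff_subset finite_subset)
  qed
  finally have "real (card (injections (insert a I) V))
      = real (card (injections I V)) * (real (card V) - real (card I))"
    using insert.prems insert.hyps by (simp add: of_nat_diff)
  moreover have "(real (card V) - real (card (insert a I))) ^ card I \<le> real (card (injections I V))"
  proof -
    have "(real (card V) - real (card (insert a I))) ^ card I \<le> (real (card V) - real (card I)) ^ card I"
      using insert.prems insert.hyps by (intro power_mono) auto
    then show ?thesis using insert by simp
  qed
  ultimately show ?case
    using insert.prems insert.hyps by (simp, subst mult.commute, intro mult_mono) auto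
qed

lemma hom_density_ge_sum:
  assumes "G \<in> weighted_graphs n" "S \<subseteq> {1..k} \<rightarrow>\<^sub>E {1..n}"
  shows "hom_density k (clique_edges k) n G
    \<ge> (\<Sum>x\<in>S. \<Prod>(i, j)\<in>edges {1..k}. G (x i) (x j)) / real n ^ k"
  unfolding hom_density_def clique_edges_eq
proof (intro divide_right_mono sum_mono2)
  fix x assume "x \<in> ({1..k} \<rightarrow>\<^sub>E {1..n}) - S"
  then show "0 \<le> (\<Prod>(i, j)\<in>edges {1..k}. G (x i) (x j))"
    using assms(1) by (intro prod_nonneg) (auto simp: edges_def weighted_graphs_def PiE_iff)
qed (use assms in \<open>auto simp: finite_funcset\<close>)

section \<open>Entropy and clique density of the planted graphs\<close>

lemma rel_entropy_one: "0 < p \<Longrightarrow> rel_entropy p 1 = ln (1 / p)"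
  by (simp add: rel_entropy_def)

definition planted_clique :: "nat \<Rightarrow> real \<Rightarrow> nat \<Rightarrow> nat \<Rightarrow> real" where
  "planted_clique a p i j = (if i = j then 0 else if i \<le> a \<and> j \<le> a then 1 else p)"

definition planted_hub :: "nat \<Rightarrow> real \<Rightarrow> nat \<Rightarrow> nat \<Rightarrow> real" where
  "planted_hub a p i j = (if i = j then 0 else if i \<le> a \<or> j \<le> a then 1 else p)"

lemma planted_clique_weighted: "0 < p \<Longrightarrow> p < 1 \<Longrightarrow> planted_clique a p \<in> weighted_graphs n"
  by (auto simp: planted_clique_def weighted_graphs_def)

lemma planted_hub_weighted: "0 < p \<Longrightarrow> p < 1 \<Longrightarrow> planted_hub a p \<in> weighted_graphs n"
  by (auto simp: planted_hub_def weighted_graphs_def)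

text \<open>An edge of weight \<open>p\<close> is free and one of weight 1 costs
  \<open>ln (1 / p)\<close>, so only the planted edges have to be counted.\<close>

lemma graph_entropy_le_card:
  assumes p: "0 < p" "p < 1" and S: "finite S"
    and G: "\<And>i j. 1 \<le> i \<Longrightarrow> i < j \<Longrightarrow> j \<le> n \<Longrightarrow> G i j = p \<or> (G i j = 1 \<and> (i, j) \<in> S)"
  shows "graph_entropy n p G \<le> real (card S) * ln (1 / p)"
proof -
  have L: "ln (1 / p) > 0" using p by simp
  have "graph_entropy n p G \<le> (\<Sum>(i, j)\<in>edges {1..n}. if (i, j) \<in> S then ln (1 / p) else 0)"
    unfolding graph_entropy_def clique_edges_def[symmetric] clique_edges_eq
  proof (intro sum_mono, clarify)
    fix i j assume "(i, j) \<in> edges {1..n}"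
    then show "rel_entropy p (G i j) \<le> (if (i, j) \<in> S then ln (1 / p) else 0)"
      using G[of i j] p L by (auto simp: edges_def rel_entropy_one rel_entropy_self less_imp_le)
  qed
  also have "\<dots> = (\<Sum>e\<in>edges {1..n} \<inter> S. ln (1 / p))"
    by (subst sum.inter_restrict) (auto simp: case_prod_unfold intro!: sum.cong)
  also have "\<dots> \<le> real (card S) * ln (1 / p)"
  proof -
    have "card (edges {1..n} \<inter> S) \<le> card S" using S by (intro card_mono) auto
    then show ?thesis using L by (simp only: sum_constant) (intro mult_right_mono; simp)
  qed
  finally show ?thesis .
qed

lemma planted_clique_entropy:
  assumes p: "0 < p" "p < 1"
  shows "graph_entropy n p (planted_clique a p) \<le> real a ^ 2 / 2 * ln (1 / p)"
proof -
  have "graph_entropy n p (planted_clique a p) \<le> real (card (edges {1..a})) * ln (1 / p)"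
    using p by (intro graph_entropy_le_card finite_edges) (auto simp: planted_clique_def edges_def)
  also have "real (card (edges {1..a})) \<le> real a ^ 2 / 2"
  proof -
    have "2 * card (edges {1..a}) \<le> a * a" using card_edges[of "{1..a}"] by simp
    then have "real (2 * card (edges {1..a})) \<le> real (a * a)" by (rule of_nat_mono)
    then show ?thesis by (simp add: power2_eq_square)
  qed
  finally show ?thesis using p by (simp add: mult_right_mono)
qed

lemma planted_hub_entropy:
  assumes p: "0 < p" "p < 1"
  shows "graph_entropy n p (planted_hub a p) \<le> real a * real n * ln (1 / p)"
proof -
  have "graph_entropy n p (planted_hub a p) \<le> real (card ({1..a} \<times> {1..n})) * ln (1 / p)"
    using p by (intro graph_entropy_le_card) (auto simp: planted_hub_def)
  then show ?thesis by simp
qed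

text \<open>Every injective map has weight at least \<open>p ^ e\<close>, with \<open>e\<close> the
  number of clique edges; those into the planted set have weight 1, that is \<open>1 - p ^ e\<close>
  more.\<close>

lemma planted_clique_density:
  assumes p: "0 < p" "p < 1" and n: "n \<ge> 1" and a: "k \<le> a" "a \<le> n"
  shows "hom_density k (clique_edges k) n (planted_clique a p)
    \<ge> p ^ card (clique_edges k) * ((real n - real k) / real n) ^ k
      + (1 - p ^ card (clique_edges k)) * ((real a - real k) / real n) ^ k"
proof -
  define I where "I = {1..k}"
  define e where "e = card (edges I)"
  let ?G = "planted_clique a p"
  let ?S = "injections I {1..n}" and ?T = "injections I {1..a}"
  have I: "finite I" "card I = k" by (auto simp: I_def)
  have fin: "finite ?S" "finite ?T" by (auto intro: finite_injections I)
  have sub: "?T \<subseteq> ?S" using a by (auto simp: injections_def PiE_iff)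
  have pe: "0 \<le> 1 - p ^ e" using p by (simp add: power_le_one)
  have "p ^ e * (real n - real k) ^ k + (1 - p ^ e) * (real a - real k) ^ k
      \<le> p ^ e * real (card ?S) + (1 - p ^ e) * real (card ?T)"
    using card_injections_ge[of I "{1..n}"] card_injections_ge[of I "{1..a}"] I a p pe
    by (intro add_mono mult_left_mono) auto
  also have "\<dots> = (\<Sum>x\<in>?S. p ^ e) + (\<Sum>x\<in>?S. if x \<in> ?T then 1 - p ^ e else 0)"
    using fin sub by (simp add: sum.If_cases Int_absorb1)
  also have "\<dots> = (\<Sum>x\<in>?S. p ^ e + (if x \<in> ?T then 1 - p ^ e else 0))"
    by (rule sum.distrib[symmetric])
  also have "\<dots> \<le> (\<Sum>x\<in>?S. \<Prod>(i, j)\<in>edges I. ?G (x i) (x j))"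
  proof (intro sum_mono)
    fix x assume x: "x \<in> ?S"
    have neq: "x i \<noteq> x j" if "(i, j) \<in> edges I" for i j
      using x that by (auto simp: injections_def inj_on_def edges_def)
    show "p ^ e + (if x \<in> ?T then 1 - p ^ e else 0) \<le> (\<Prod>(i, j)\<in>edges I. ?G (x i) (x j))"
    proof (cases "x \<in> ?T")
      case True
      have "(\<Prod>(i, j)\<in>edges I. ?G (x i) (x j)) = (\<Prod>e\<in>edges I. 1)"
        using True neq by (intro prod.cong refl)
          (auto simp: planted_clique_def injections_def PiE_iff edges_def)
      then show ?thesis using True by simp
    next
      case False
      have "(\<Prod>e\<in>edges I. p) \<le> (\<Prod>(i, j)\<in>edges I. ?G (x i) (x j))"
        using p neq by (intro prod_mono) (auto simp: planted_clique_def)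
      then show ?thesis using False by (simp add: e_def)
    qed
  qed
  finally have "(p ^ e * (real n - real k) ^ k + (1 - p ^ e) * (real a - real k) ^ k) / real n ^ k
      \<le> (\<Sum>x\<in>?S. \<Prod>(i, j)\<in>edges I. ?G (x i) (x j)) / real n ^ k"
    by (rule divide_right_mono) simp
  also have "\<dots> \<le> hom_density k (clique_edges k) n ?G"
    unfolding I_def using p by (intro hom_density_ge_sum planted_clique_weighted)
      (auto simp: injections_def)
  finally show ?thesis
    by (simp add: clique_edges_eq I_def e_def power_divide add_divide_distrib)
qed

text \<open>Two kinds of injective maps are counted: those avoiding the hub, and those sending
  exactly one vertex into it, whose \<open>N\<close> edges at that vertex have weight 1. All others
  are dropped.\<close>

lemma planted_hub_density:
  assumes p: "0 < p" "p < 1" and n: "n \<ge> 1" and a: "a + Suc N \<le> n"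
  defines "t \<equiv> (real n - real a - real (Suc N)) / real n" and "e \<equiv> card (clique_edges (Suc N))"
  shows "hom_density (Suc N) (clique_edges (Suc N)) n (planted_hub a p)
    \<ge> p ^ e * t ^ Suc N + real (Suc N) * (real a / real n * p ^ (e - N) * t ^ N)"
proof -
  define k where "k = Suc N"
  define I where "I = {1..k}"
  have e: "e = card (edges I)" by (simp only: e_def clique_edges_eq I_def k_def)
  let ?G = "planted_hub a p"
  define V where "V = {Suc a..n}"
  have V: "finite V" "card V = n - a" by (auto simp: V_def)
  have I: "finite I" "card I = k" by (auto simp: I_def)
  define S0 where "S0 = injections I V"
  define S where "S i = (\<lambda>(x, y). x(i := y)) ` (injections (I - {i}) V \<times> {1..a})" for i
  define w where "w x = (\<Prod>(i, j)\<in>edges I. ?G (x i) (x j))" for x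
  have fin: "finite S0" "finite (S i)" for i
    using I V by (auto simp: S0_def S_def finite_injections)
  have S0V: "x j \<in> V" if "x \<in> S0" "j \<in> I" for x j
    using that by (auto simp: S0_def injections_def)
  have SE: "\<exists>y\<in>injections (I - {i}) V. \<exists>z\<in>{1..a}. x = y(i := z)" if "x \<in> S i" for x i
    using that by (auto simp: S_def)
  have SA: "x i \<in> {1..a}" if "x \<in> S i" for x i using that by (auto simp: S_def)
  have SV: "x j \<in> V" if xS: "x \<in> S i" and "j \<in> I" "j \<noteq> i" for x i j
  proof -
    obtain y z where x: "x = y(i := z)" "y \<in> (I - {i}) \<rightarrow>\<^sub>E V"
      using SE[OF xS] unfolding injections_def by blast
    have "y j \<in> V" using x(2) by (rule PiE_mem) (use that in auto)
    then show ?thesis using x(1) that by simp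
  qed
  have SP: "x \<in> I \<rightarrow>\<^sub>E {1..n}" if xS: "x \<in> S i" and "i \<in> I" for x i
  proof -
    obtain y z where x: "x = y(i := z)" "y \<in> (I - {i}) \<rightarrow>\<^sub>E V" "z \<in> {1..a}"
      using SE[OF xS] unfolding injections_def by blast
    have "V \<subseteq> {1..n}" by (auto simp: V_def)
    then have "y \<in> (I - {i}) \<rightarrow>\<^sub>E {1..n}" using x(2) PiE_mono[of "I - {i}" "\<lambda>_. V" "\<lambda>_. {1..n}"] by blast
    then have "y(i := z) \<in> insert i (I - {i}) \<rightarrow>\<^sub>E {1..n}" using x(3) a by (intro PiE_fun_upd) auto
    then show ?thesis using x(1) that by (simp add: insert_absorb)
  qed
  have cardS: "real a * (real n - real a - real k) ^ N \<le> real (card (S i))" if i: "i \<in> I" for i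
  proof -
    have cJ: "card (I - {i}) = N" using I i by (simp add: k_def)
    have "card (S i) = card (injections (I - {i}) V) * a"
      unfolding S_def
      by (subst card_image) (auto intro!: inj_on_fun_upd_Sigma[of i "I - {i}" _ V] simp: injections_def card_cartesian_product)
    moreover have "(real n - real a - real k) ^ N \<le> real (card (injections (I - {i}) V))"
    proof -
      \<comment> \<open>Only \<open>N = k - 1\<close> vertices go outside the hub; subtracting
        \<open>k\<close> instead lets the same \<open>t\<close> serve both kinds of maps.\<close>
      have "(real n - real a - real k) ^ N \<le> (real (card V) - real (card (I - {i}))) ^ card (I - {i})"
        unfolding cJ using V a by (intro power_mono) (auto simp: k_def of_nat_diff)
      also have "\<dots> \<le> real (card (injections (I - {i}) V))"
        using I V cJ a by (intro card_injections_ge) auto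
      finally show ?thesis .
    qed
    ultimately show ?thesis by (simp add: mult.commute mult_left_mono)
  qed
  have cardS0: "(real n - real a - real k) ^ k \<le> real (card S0)"
    using card_injections_ge[OF I(1) V(1)] I V a by (simp add: S0_def k_def of_nat_diff)
  have w0: "p ^ e \<le> w x" if x: "x \<in> S0" for x
  proof -
    have neq: "x i \<noteq> x j" if "(i, j) \<in> edges I" for i j
      using x that by (auto simp: S0_def injections_def inj_on_def edges_def)
    have "(\<Prod>e\<in>edges I. p) \<le> w x"
      unfolding w_def using p neq by (intro prod_mono) (auto simp: planted_hub_def)
    then show ?thesis by (simp add: e)
  qed
  have wi: "p ^ (e - N) \<le> w x" if x: "x \<in> S i" and i: "i \<in> I" for x i
  proof -
    define J where "J = I - {i}"
    have J: "finite J" "i \<notin> J" "insert i J = I" "card J = N" using I i by (auto simp: J_def k_def)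
    have cJ: "card (edges J) = e - N" using card_edges_insert[OF J(1,2)] J e by simp
    have inj: "inj_on x J" using SE[OF x] by (auto simp: injections_def J_def inj_on_def)
    then have neq: "x i' \<noteq> x j" if "(i', j) \<in> edges J" for i' j
      using that by (auto simp: inj_on_def edges_def)
    have "w x = (\<Prod>(i', j)\<in>edges J. ?G (x i') (x j)) * (\<Prod>j\<in>J. ?G (x i) (x j))"
      unfolding w_def J(3)[symmetric]
      by (rule prod_edges_insert[OF J(1,2)]) (auto simp: planted_hub_def)
    also have "(\<Prod>j\<in>J. ?G (x i) (x j)) = (\<Prod>j\<in>J. 1)"
    proof (intro prod.cong refl)
      fix j assume "j \<in> J"
      then show "?G (x i) (x j) = 1"
        using SA[OF x] SV[OF x, of j] by (auto simp: J_def V_def planted_hub_def)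
    qed
    finally have "w x = (\<Prod>(i', j)\<in>edges J. ?G (x i') (x j))" by simp
    moreover have "(\<Prod>e\<in>edges J. p) \<le> (\<Prod>(i', j)\<in>edges J. ?G (x i') (x j))"
      using p neq by (intro prod_mono) (auto simp: planted_hub_def)
    ultimately show ?thesis by (simp add: cJ)
  qed
  have disjS: "S i \<inter> S j = {}" if "i \<in> I" "j \<in> I" "i \<noteq> j" for i j
  proof (intro equals0I)
    fix x assume "x \<in> S i \<inter> S j"
    then have "x i \<in> {1..a}" "x i \<in> V" using SA[of x i] SV[of x j i] that by auto
    then show False by (simp add: V_def)
  qed
  have disj0: "S0 \<inter> (\<Union>i\<in>I. S i) = {}"
  proof (intro equals0I)
    fix x assume "x \<in> S0 \<inter> (\<Union>i\<in>I. S i)"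
    then obtain i where i: "x \<in> S0" "i \<in> I" "x \<in> S i" by auto
    then have "x i \<in> {1..a}" "x i \<in> V" using SA[of x i] S0V[of x i] by auto
    then show False by (simp add: V_def)
  qed
  have "p ^ e * (real n - real a - real k) ^ k
      + real k * (real a * (real n - real a - real k) ^ N * p ^ (e - N))
      \<le> real (card S0) * p ^ e + (\<Sum>i\<in>I. real (card (S i)) * p ^ (e - N))"
  proof (intro add_mono)
    show "p ^ e * (real n - real a - real k) ^ k \<le> real (card S0) * p ^ e"
      using cardS0 p by (simp add: mult.commute)
    have "(\<Sum>i\<in>I. real a * (real n - real a - real k) ^ N * p ^ (e - N)) \<le> (\<Sum>i\<in>I. real (card (S i)) * p ^ (e - N))"
      using cardS p by (intro sum_mono mult_right_mono) auto
    then show "real k * (real a * (real n - real a - real k) ^ N * p ^ (e - N))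
        \<le> (\<Sum>i\<in>I. real (card (S i)) * p ^ (e - N))" using I by simp
  qed
  also have "\<dots> \<le> (\<Sum>x\<in>S0. w x) + (\<Sum>i\<in>I. \<Sum>x\<in>S i. w x)"
    using w0 wi by (intro add_mono sum_mono sum_bounded_below)
  also have "\<dots> = (\<Sum>x\<in>S0 \<union> (\<Union>i\<in>I. S i). w x)"
    using fin I disj0 disjS by (subst sum.union_disjoint) (auto simp: sum.UNION_disjoint)
  finally have "(p ^ e * (real n - real a - real k) ^ k
      + real k * (real a * (real n - real a - real k) ^ N * p ^ (e - N))) / real n ^ k
      \<le> (\<Sum>x\<in>S0 \<union> (\<Union>i\<in>I. S i). w x) / real n ^ k"
    by (rule divide_right_mono) simp
  also have "\<dots> \<le> hom_density k (clique_edges k) n ?G"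
    unfolding w_def I_def
  proof (intro hom_density_ge_sum planted_hub_weighted p)
    show "S0 \<union> (\<Union>i\<in>{1..k}. S i) \<subseteq> {1..k} \<rightarrow>\<^sub>E {1..n}"
    proof -
      have "V \<subseteq> {1..n}" by (auto simp: V_def)
      then have "S0 \<subseteq> I \<rightarrow>\<^sub>E {1..n}"
        using PiE_mono[of I "\<lambda>_. V" "\<lambda>_. {1..n}"] unfolding S0_def injections_def by blast
      then show ?thesis using SP unfolding I_def by blast
    qed
  qed
  also have "(p ^ e * (real n - real a - real k) ^ k
      + real k * (real a * (real n - real a - real k) ^ N * p ^ (e - N))) / real n ^ k
      = p ^ e * t ^ k + real k * (real a / real n * p ^ (e - N) * t ^ N)"
  proof -
    have t: "t = (real n - real a - real k) / real n" by (simp add: t_def k_def)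
    have "(p ^ e * X ^ k + real k * (real a * X ^ N * p ^ (e - N))) / real n ^ k
        = p ^ e * (X / real n) ^ k + real k * (real a / real n * p ^ (e - N) * (X / real n) ^ N)" for X :: real
      by (simp add: add_divide_distrib power_divide k_def mult_ac)
    then show ?thesis unfolding t by blast
  qed
  finally show ?thesis by (simp only: k_def)
qed

section \<open>Asymptotics\<close>

definition admissible :: "nat \<Rightarrow> nat \<Rightarrow> real \<Rightarrow> real \<Rightarrow> (nat \<Rightarrow> nat \<Rightarrow> real) set" where
  "admissible k n p \<delta> = {G \<in> weighted_graphs n.
     hom_density k (clique_edges k) n G \<ge> (1 + \<delta>) * p ^ card (clique_edges k)}"

lemma card_clique_edges: "2 * card (clique_edges (Suc N)) = Suc N * N"
  using card_edges[of "{1..Suc N}"] by (simp only: clique_edges_eq card_atLeastAtMost finite_atLeastAtMost) simp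

text \<open>With \<open>y = \<phi> powr (k / 2)\<close> the cost \<open>y powr (2 / k) / 2\<close>
  is concave in \<open>y\<close>, so the cheapest way to reach \<open>D\<close> is an endpoint: all
  in \<phi> or all in \<theta>.\<close>

lemma tradeoff_ge:
  fixes D \<phi> \<theta> k :: real
  assumes "D > 0" "k \<ge> 2" "\<phi> \<ge> 0" "\<theta> \<ge> 0" and le: "D \<le> \<phi> powr (k / 2) + k * \<theta>"
  shows "min (1/2 * D powr (2 / k)) (D / k) \<le> \<phi> / 2 + \<theta>"
    and "\<theta> = 0 \<Longrightarrow> 1/2 * D powr (2 / k) \<le> \<phi> / 2"
proof -
  define y where "y = \<phi> powr (k / 2)"
  have y: "y \<ge> 0" "\<phi> = y powr (2 / k)" using assms by (auto simp: y_def powr_powr)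
  have big: "D powr (2 / k) \<le> \<phi>" if "D \<le> y"
    unfolding y(2) using that assms by (intro powr_mono2) auto
  then show "1/2 * D powr (2 / k) \<le> \<phi> / 2" if "\<theta> = 0" using le that by (simp add: y_def)
  show "min (1/2 * D powr (2 / k)) (D / k) \<le> \<phi> / 2 + \<theta>"
  proof (cases "D \<le> y")
    case True
    then show ?thesis using big assms by (simp add: min_le_iff_disj)
  next
    case False
    \<comment> \<open>\<alpha> is the share of \<open>D\<close> carried by \<phi>; the cost is at
      least the mixture of the two endpoint costs with weights \<alpha> and
      \<open>1 - \<alpha>\<close>.\<close>
    define \<alpha> where "\<alpha> = y / D"
    have \<alpha>: "0 \<le> \<alpha>" "\<alpha> \<le> 1" "y = \<alpha> * D" using False y assms by (auto simp: \<alpha>_def)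
    have "\<alpha> \<le> \<alpha> powr (2 / k)"
    proof (cases "\<alpha> = 0")
      case False
      then have "\<alpha> powr 1 \<le> \<alpha> powr (2 / k)" using \<alpha> assms by (intro powr_mono') auto
      then show ?thesis using \<alpha> by simp
    qed simp
    then have 1: "\<alpha> * D powr (2 / k) \<le> \<phi>"
      unfolding y(2) \<alpha>(3) using \<alpha> assms by (simp add: powr_mult mult_right_mono)
    have "(1 - \<alpha>) * D \<le> k * \<theta>" using le \<alpha> by (simp add: y_def[symmetric] algebra_simps)
    then have 2: "(1 - \<alpha>) * (D / k) \<le> \<theta>" using assms by (simp add: field_simps)
    let ?m = "min (1/2 * D powr (2 / k)) (D / k)"
    have "?m = \<alpha> * ?m + (1 - \<alpha>) * ?m" by (simp add: algebra_simps)
    also have "\<dots> \<le> \<alpha> * (1/2 * D powr (2 / k)) + (1 - \<alpha>) * (D / k)"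
      by (intro add_mono mult_left_mono min.cobounded1 min.cobounded2) (use \<alpha> in auto)
    also have "\<dots> \<le> \<phi> / 2 + \<theta>" using 1 2 by simp
    finally show ?thesis .
  qed
qed

text \<open>The structure lemma is combined with the tradeoff at
  \<open>\<delta> - \<epsilon>\<close>, and \<epsilon> is chosen by continuity of the optimal cost.
  The second alternative for \<open>m\<close> is the regime without hubs.\<close>

lemma entropy_lower_bound:
  fixes \<delta> \<zeta> :: real and p :: "nat \<Rightarrow> real"
  assumes N: "N \<ge> 2" and \<delta>: "\<delta> > 0" and \<zeta>: "\<zeta> > 0"
    and p0: "filterlim p (at_right 0) sequentially"
    and m: "m = min (1 / 2 * \<delta> powr (2 / real (Suc N))) (\<delta> / real (Suc N))
      \<or> (m = 1 / 2 * \<delta> powr (2 / real (Suc N)) \<and> (\<lambda>n. real n * p n ^ N) \<longlonglongrightarrow> 0)"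
  shows "eventually (\<lambda>n. \<forall>G\<in>admissible (Suc N) n (p n) \<delta>.
    (m - \<zeta>) * (real n ^ 2 * p n ^ N * ln (1 / p n)) \<le> graph_entropy n (p n) G) sequentially"
proof -
  define k where "k = real (Suc N)"
  have k: "k \<ge> 2" using N by (simp add: k_def)
  define f where "f x = min (1/2 * x powr (2 / k)) (x / k)" for x
  define g where "g x = 1/2 * x powr (2 / k)" for x
  have "1 / 2 * \<delta> powr (2 / real (Suc N)) > 0" "\<delta> / real (Suc N) > 0" using \<delta> by simp_all
  then have m_pos: "m > 0" using m by (elim disjE conjE) (simp_all only: min_less_iff_conj)
  have lim: "((\<lambda>\<epsilon>. \<delta> - \<epsilon>) \<longlongrightarrow> \<delta>) (at_right 0)" by (intro tendsto_eq_intros) auto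
  have limg: "((\<lambda>\<epsilon>. g (\<delta> - \<epsilon>)) \<longlongrightarrow> g \<delta>) (at_right 0)"
    unfolding g_def using \<delta> k by (intro tendsto_intros lim) auto
  have limf: "((\<lambda>\<epsilon>. f (\<delta> - \<epsilon>)) \<longlongrightarrow> f \<delta>) (at_right 0)"
    unfolding f_def using \<delta> k by (intro tendsto_intros lim) auto
  obtain \<epsilon> where \<epsilon>: "\<epsilon> > 0" "\<epsilon> < \<delta>" "\<epsilon> < \<zeta> / 2" "f \<delta> - \<zeta> / 2 < f (\<delta> - \<epsilon>)" "g \<delta> - \<zeta> / 2 < g (\<delta> - \<epsilon>)"
  proof -
    have "eventually (\<lambda>\<epsilon>. \<epsilon> > 0 \<and> \<epsilon> < \<delta> \<and> \<epsilon> < \<zeta> / 2 \<and> f \<delta> - \<zeta> / 2 < f (\<delta> - \<epsilon>) \<and> g \<delta> - \<zeta> / 2 < g (\<delta> - \<epsilon>)) (at_right 0)"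
    proof (intro eventually_conj)
      show "eventually (\<lambda>\<epsilon>. \<epsilon> > 0) (at_right (0::real))" by (rule eventually_at_right_less)
      show "eventually (\<lambda>\<epsilon>. \<epsilon> < \<delta>) (at_right 0)"
        using \<delta> by (rule order_tendstoD(2)[OF tendsto_ident_at])
      have "\<zeta> / 2 > 0" using \<zeta> by simp
      then show "eventually (\<lambda>\<epsilon>. \<epsilon> < \<zeta> / 2) (at_right 0)"
        by (rule order_tendstoD(2)[OF tendsto_ident_at])
      show "eventually (\<lambda>\<epsilon>. f \<delta> - \<zeta> / 2 < f (\<delta> - \<epsilon>)) (at_right 0)"
        using \<zeta> by (intro order_tendstoD(1)[OF limf]) auto
      show "eventually (\<lambda>\<epsilon>. g \<delta> - \<zeta> / 2 < g (\<delta> - \<epsilon>)) (at_right 0)"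
        using \<zeta> by (intro order_tendstoD(1)[OF limg]) auto
    qed
    then show ?thesis using that eventually_happens'[OF trivial_limit_at_right_real] by blast
  qed
  obtain \<beta> where \<beta>: "\<beta> > 0" and ev: "eventually (\<lambda>p. \<forall>n\<ge>1. \<forall>G\<in>weighted_graphs n.
     (1 + \<delta>) * p ^ card (clique_edges (Suc N)) \<le> hom_density (Suc N) (clique_edges (Suc N)) n G \<longrightarrow>
     graph_entropy n p G \<le> m * (real n ^ 2 * p ^ N * ln (1 / p)) \<longrightarrow>
     (\<exists>\<phi>\<ge>0. \<exists>\<theta>\<ge>0. \<delta> - \<epsilon> \<le> \<phi> powr (real (Suc N) / 2) + real (Suc N) * \<theta>
        \<and> (\<phi> / 2 + \<theta> - \<epsilon>) * (real n ^ 2 * p ^ N * ln (1 / p)) \<le> graph_entropy n p G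
        \<and> (\<beta> * real n * p ^ N < 1 \<longrightarrow> \<theta> = 0))) (at_right 0)"
    using clique_entropy_structure[OF N \<epsilon>(1) m_pos] by blast
  have ev_pos: "eventually (\<lambda>p::real. 0 < p \<and> p < 1) (at_right 0)"
    using eventually_at_right_field[of "\<lambda>p. 0 < p \<and> p < 1" "0::real"] zero_less_one by blast
  \<comment> \<open>In the second alternative the hub count is eventually below 1, which forces
    \<theta> to be 0.\<close>
  have ev_m: "eventually (\<lambda>n. m = f \<delta> \<or> (m = g \<delta> \<and> \<beta> * real n * p n ^ N < 1)) sequentially"
    using m
  proof
    assume "m = 1 / 2 * \<delta> powr (2 / real (Suc N)) \<and> (\<lambda>n. real n * p n ^ N) \<longlonglongrightarrow> 0"
    then have m: "m = g \<delta>" and lim: "(\<lambda>n. real n * p n ^ N) \<longlonglongrightarrow> 0" by (auto simp: g_def k_def)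
    have "eventually (\<lambda>n. real n * p n ^ N < 1 / \<beta>) sequentially"
      using order_tendstoD(2)[OF lim, of "1 / \<beta>"] \<beta> by simp
    then show ?thesis by eventually_elim (use m \<beta> in \<open>simp add: field_simps\<close>)
  qed (simp add: f_def k_def)
  show ?thesis
    using eventually_compose_filterlim[OF ev p0] eventually_compose_filterlim[OF ev_pos p0]
      eventually_ge_at_top[of 1] ev_m
  proof eventually_elim
    case (elim n)
    define Q where "Q = real n ^ 2 * p n ^ N * ln (1 / p n)"
    have Q: "Q > 0" using elim by (simp add: Q_def)
    show ?case
    proof
      fix G assume "G \<in> admissible (Suc N) n (p n) \<delta>"
      then have G: "G \<in> weighted_graphs n"
        "(1 + \<delta>) * p n ^ card (clique_edges (Suc N)) \<le> hom_density (Suc N) (clique_edges (Suc N)) n G"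
        by (auto simp: admissible_def)
      have "(m - \<zeta>) * Q \<le> graph_entropy n (p n) G"
      \<comment> \<open>The constant \<open>m\<close> itself serves as \<open>C0\<close>: a graph of
        larger entropy satisfies the bound outright.\<close>
      proof (cases "graph_entropy n (p n) G \<le> m * Q")
        case True
        then obtain \<phi> \<theta> where *: "\<phi> \<ge> 0" "\<theta> \<ge> 0" "\<delta> - \<epsilon> \<le> \<phi> powr (k / 2) + k * \<theta>"
          "(\<phi> / 2 + \<theta> - \<epsilon>) * Q \<le> graph_entropy n (p n) G" "\<beta> * real n * p n ^ N < 1 \<longrightarrow> \<theta> = 0"
          using elim(1,3) G unfolding Q_def k_def by blast
        have "m - \<zeta> / 2 \<le> \<phi> / 2 + \<theta>"
          using elim(4)
        proof
          assume "m = f \<delta>"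
          moreover have "f (\<delta> - \<epsilon>) \<le> \<phi> / 2 + \<theta>"
            unfolding f_def using \<epsilon> by (intro tradeoff_ge(1) k *) auto
          ultimately show ?thesis using \<epsilon> by linarith
        next
          assume g: "m = g \<delta> \<and> \<beta> * real n * p n ^ N < 1"
          then have "\<theta> = 0" using *(5) by simp
          then have "g (\<delta> - \<epsilon>) \<le> \<phi> / 2 + \<theta>"
            using tradeoff_ge(2)[OF _ k *(1,2,3)] \<epsilon> by (simp add: g_def)
          then show ?thesis using g \<epsilon> by linarith
        qed
        then have "(m - \<zeta>) * Q \<le> (\<phi> / 2 + \<theta> - \<epsilon>) * Q" using \<epsilon> Q by (intro mult_right_mono) auto
        then show ?thesis using *(4) by simp
      next
        case False
        moreover have "(m - \<zeta>) * Q \<le> m * Q" using \<zeta> Q by (intro mult_right_mono) auto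
        ultimately show ?thesis by simp
      qed
      then show "(m - \<zeta>) * (real n ^ 2 * p n ^ N * ln (1 / p n)) \<le> graph_entropy n (p n) G"
        by (simp add: Q_def)
    qed
  qed
qed

lemma clique_upper_bound:
  fixes \<delta> \<zeta> :: real and p :: "nat \<Rightarrow> real"
  assumes N: "N \<ge> 2" and \<delta>: "\<delta> > 0" and \<zeta>: "\<zeta> > 0"
    and p: "\<And>n. n \<ge> 1 \<Longrightarrow> 0 < p n \<and> p n < 1" and p0: "p \<longlonglongrightarrow> 0"
    and big: "filterlim (\<lambda>n. real n ^ 2 * p n ^ N) at_top sequentially"
  shows "eventually (\<lambda>n. \<exists>G\<in>admissible (Suc N) n (p n) \<delta>.
    graph_entropy n (p n) G \<le> (1 / 2 * \<delta> powr (2 / real (Suc N)) + \<zeta>)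
      * (real n ^ 2 * p n ^ N * ln (1 / p n))) sequentially"
proof -
  define k where "k = Suc N"
  define e where "e = card (clique_edges k)"
  have e2: "2 * e = N * k" using card_clique_edges[of N] by (simp add: e_def k_def)
  have e_pos: "e > 0" using e2 N by (cases e) (auto simp: k_def)
  \<comment> \<open>\<xi> is the room for the factors tending to 1 in the density of the planted
    graph.\<close>
  obtain \<xi> where \<xi>: "\<xi> > 0" "1/2 * (\<delta> + \<xi>) powr (2 / real k) < 1/2 * \<delta> powr (2 / real k) + \<zeta>"
  proof -
    have "((\<lambda>\<xi>. 1/2 * (\<delta> + \<xi>) powr (2 / real k)) \<longlongrightarrow> 1/2 * (\<delta> + 0) powr (2 / real k)) (at_right 0)"
      using \<delta> by (intro tendsto_intros) auto
    then have "eventually (\<lambda>\<xi>. 1/2 * (\<delta> + \<xi>) powr (2 / real k) < 1/2 * \<delta> powr (2 / real k) + \<zeta>) (at_right 0)"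
      using \<zeta> by (intro order_tendstoD(2)) auto
    then have "eventually (\<lambda>\<xi>. \<xi> > 0 \<and> 1/2 * (\<delta> + \<xi>) powr (2 / real k) < 1/2 * \<delta> powr (2 / real k) + \<zeta>) (at_right 0)"
      using eventually_at_right_less[of 0] by eventually_elim auto
    then show ?thesis using that eventually_happens'[OF trivial_limit_at_right_real] by blast
  qed
  define c where "c = (\<delta> + \<xi>) powr (1 / real k)"
  have "k > 0" by (simp add: k_def)
  then have c: "c > 0" "c ^ k = \<delta> + \<xi>" "c\<^sup>2 = (\<delta> + \<xi>) powr (2 / real k)"
    using \<delta> \<xi> by (simp_all add: c_def powr_power)
  define s where "s n = real n * sqrt (p n ^ N)" for n
  \<comment> \<open>As \<open>sqrt (p n ^ N) ^ k = p n ^ e\<close>, a clique on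
    \<open>c * s n\<close> vertices adds density \<open>(\<delta> + \<xi>) * p n ^ e\<close>. The
    summand \<open>k\<close> offsets the loss in counting injections; both it and the rounding are
    negligible as \<open>s\<close> tends to infinity.\<close>
  define a where "a n = nat \<lceil>c * s n\<rceil> + k" for n
  have s_top: "filterlim s at_top sequentially"
  proof -
    have "filterlim (\<lambda>n. sqrt (real n ^ 2 * p n ^ N)) at_top sequentially"
      by (rule filterlim_compose[OF sqrt_at_top big])
    then show ?thesis by (simp add: s_def[abs_def] real_sqrt_mult)
  qed
  have inv: "(\<lambda>n. (real k + 1) / real n) \<longlonglongrightarrow> 0" by real_asymp
  have ev1: "eventually (\<lambda>n. c * sqrt (p n ^ N) + (real k + 1) / real n < 1) sequentially"
  proof -
    have "(\<lambda>n. c * sqrt (p n ^ N) + (real k + 1) / real n) \<longlonglongrightarrow> c * sqrt (0 ^ N) + 0"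
      by (intro tendsto_intros p0 inv)
    then show ?thesis using N by (intro order_tendstoD(2)) (auto simp: power_0_left)
  qed
  have ev2: "eventually (\<lambda>n. 1 + \<delta> < (1 - real k / real n) ^ k + (1 - p n ^ e) * (\<delta> + \<xi>)) sequentially"
  proof -
    have "(\<lambda>n. real k / real n) \<longlonglongrightarrow> 0" by real_asymp
    then have "(\<lambda>n. (1 - real k / real n) ^ k + (1 - p n ^ e) * (\<delta> + \<xi>))
        \<longlonglongrightarrow> (1 - 0) ^ k + (1 - 0 ^ e) * (\<delta> + \<xi>)"
      by (intro tendsto_intros p0)
    then show ?thesis using \<xi> e_pos by (intro order_tendstoD(1)) (auto simp: power_0_left)
  qed
  have ev3: "eventually (\<lambda>n. 1/2 * (c + (real k + 1) / s n)\<^sup>2 < 1/2 * \<delta> powr (2 / real k) + \<zeta>) sequentially"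
  proof -
    have "(\<lambda>n. (real k + 1) / s n) \<longlonglongrightarrow> 0"
      by (rule tendsto_divide_0[OF tendsto_const filterlim_at_top_imp_at_infinity[OF s_top]])
    then have "(\<lambda>n. 1/2 * (c + (real k + 1) / s n)\<^sup>2) \<longlonglongrightarrow> 1/2 * (c + 0)\<^sup>2"
      by (intro tendsto_intros)
    then show ?thesis using \<xi>(2) c(3) by (intro order_tendstoD(2)) auto
  qed
  have ev4: "eventually (\<lambda>n. s n > 0) sequentially" using s_top by (simp add: filterlim_at_top_dense)
  show ?thesis using ev1 ev2 ev3 ev4 eventually_ge_at_top[of 1]
  proof eventually_elim
    case (elim n)
    have pn: "0 < p n" "p n < 1" using p elim by auto
    have n: "real n > 0" using elim by simp
    have L: "ln (1 / p n) > 0" using pn by simp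
    have cs: "c * s n \<ge> 0" using c(1) elim by simp
    have a_ge: "c * s n \<le> real (a n) - real k" using cs unfolding a_def by linarith
    have a_le: "real (a n) \<le> c * s n + (real k + 1)" using cs unfolding a_def by linarith
    have a_n: "a n \<le> n"
    proof -
      have "c * s n + (real k + 1) = (c * sqrt (p n ^ N) + (real k + 1) / real n) * real n"
        using n by (simp add: s_def field_simps)
      also have "\<dots> \<le> 1 * real n" using elim n by (intro mult_right_mono) auto
      finally show ?thesis using a_le by simp
    qed
    have dens: "(1 + \<delta>) * p n ^ e \<le> hom_density k (clique_edges k) n (planted_clique (a n) (p n))"
    proof -
      have "sqrt (p n ^ N) ^ k = p n ^ e"
      proof -
        have "(sqrt (p n ^ N) ^ k)\<^sup>2 = (p n ^ e)\<^sup>2"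
          using pn e2 by (simp add: power_mult[symmetric] mult.commute[of k 2] power_mult[of _ 2 k])
            (simp add: power_mult[symmetric] mult.commute)
        then show ?thesis using pn by (simp add: power2_eq_iff_nonneg)
      qed
      then have "(\<delta> + \<xi>) * p n ^ e = (c * s n / real n) ^ k"
        using n c(2) by (simp add: s_def power_mult_distrib)
      also have "\<dots> \<le> ((real (a n) - real k) / real n) ^ k"
        using a_ge c n elim by (intro power_mono divide_right_mono) auto
      finally have "(1 - p n ^ e) * ((\<delta> + \<xi>) * p n ^ e) \<le> (1 - p n ^ e) * ((real (a n) - real k) / real n) ^ k"
        using pn by (intro mult_left_mono) (auto simp: power_le_one)
      moreover have "(1 + \<delta>) * p n ^ e \<le> ((1 - real k / real n) ^ k + (1 - p n ^ e) * (\<delta> + \<xi>)) * p n ^ e"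
        using elim pn by (intro mult_right_mono) auto
      moreover have "1 - real k / real n = (real n - real k) / real n" using n by (simp add: field_simps)
      ultimately have "(1 + \<delta>) * p n ^ e \<le> p n ^ e * ((real n - real k) / real n) ^ k
          + (1 - p n ^ e) * ((real (a n) - real k) / real n) ^ k"
        by (simp add: algebra_simps)
      then show ?thesis
        using planted_clique_density[OF pn, of n k "a n"] elim a_n by (simp add: e_def a_def)
    qed
    have "graph_entropy n (p n) (planted_clique (a n) (p n)) \<le> real (a n) ^ 2 / 2 * ln (1 / p n)"
      by (rule planted_clique_entropy[OF pn])
    also have "\<dots> \<le> (c * s n + (real k + 1))\<^sup>2 / 2 * ln (1 / p n)"
      using a_le L by (intro mult_right_mono divide_right_mono power_mono) auto
    also have "\<dots> = 1/2 * (c + (real k + 1) / s n)\<^sup>2 * ((s n)\<^sup>2 * ln (1 / p n))"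
    proof -
      have "c * s n + (real k + 1) = (c + (real k + 1) / s n) * s n" using elim by (simp add: field_simps)
      then show ?thesis by (simp add: power_mult_distrib)
    qed
    also have "\<dots> \<le> (1/2 * \<delta> powr (2 / real k) + \<zeta>) * ((s n)\<^sup>2 * ln (1 / p n))"
      using elim L by (intro mult_right_mono) auto
    also have "(s n)\<^sup>2 = real n ^ 2 * p n ^ N" using pn by (simp add: s_def power_mult_distrib)
    finally show ?case
      using dens planted_clique_weighted[OF pn]
      by (intro bexI[of _ "planted_clique (a n) (p n)"]) (auto simp: admissible_def k_def e_def)
  qed
qed

lemma hub_upper_bound:
  fixes \<delta> \<zeta> :: real and p :: "nat \<Rightarrow> real"
  assumes N: "N \<ge> 2" and \<delta>: "\<delta> > 0" and \<zeta>: "\<zeta> > 0"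
    and p: "\<And>n. n \<ge> 1 \<Longrightarrow> 0 < p n \<and> p n < 1" and p0: "p \<longlonglongrightarrow> 0"
    and big: "filterlim (\<lambda>n. real n * p n ^ N) at_top sequentially"
  shows "eventually (\<lambda>n. \<exists>G\<in>admissible (Suc N) n (p n) \<delta>.
    graph_entropy n (p n) G \<le> (\<delta> / real (Suc N) + \<zeta>)
      * (real n ^ 2 * p n ^ N * ln (1 / p n))) sequentially"
proof -
  define k where "k = Suc N"
  define e where "e = card (clique_edges k)"
  have e2: "2 * e = N * k" using card_clique_edges[of N] by (simp add: e_def k_def)
  have eN: "N \<le> e" using e2 N by (cases N) (auto simp: k_def)
  \<comment> \<open>Half of \<zeta> makes \<open>real k * c\<close> exceed \<delta> strictly; the
    other half pays for rounding up in \<open>a\<close>, once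
    \<open>s n \<ge> 2 / \<zeta>\<close>.\<close>
  define c where "c = \<delta> / real k + \<zeta> / 2"
  have k: "real k > 0" by (simp add: k_def)
  then have "real k * c = \<delta> + real k * \<zeta> / 2" by (simp add: c_def field_simps)
  then have c: "c > 0" "\<delta> < real k * c"
    using \<delta> \<zeta> k by (simp_all add: c_def add_pos_pos)
  define s where "s n = real n * p n ^ N" for n
  define a where "a n = nat \<lceil>c * s n\<rceil>" for n
  \<comment> \<open>A lower bound, free of the rounding, for the fraction of vertices left outside
    the hub after removing \<open>k\<close> more.\<close>
  define t where "t n = 1 - (c * p n ^ N + (real k + 1) / real n)" for n
  have inv: "(\<lambda>n. (real k + 1) / real n) \<longlonglongrightarrow> 0" by real_asymp
  have t: "t \<longlonglongrightarrow> 1"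
  proof -
    have "t \<longlonglongrightarrow> 1 - (c * 0 ^ N + 0)" unfolding t_def by (intro tendsto_intros p0 inv)
    then show ?thesis using N by (simp add: power_0_left)
  qed
  have ev1: "eventually (\<lambda>n. 0 < t n) sequentially" using t by (intro order_tendstoD(1)) auto
  have ev2: "eventually (\<lambda>n. 1 + \<delta> < t n ^ k + real k * c * t n ^ N) sequentially"
  proof -
    have "(\<lambda>n. t n ^ k + real k * c * t n ^ N) \<longlonglongrightarrow> 1 ^ k + real k * c * 1 ^ N"
      by (intro tendsto_intros t)
    then show ?thesis using c by (intro order_tendstoD(1)) auto
  qed
  have ev3: "eventually (\<lambda>n. 2 / \<zeta> \<le> s n) sequentially"
    using big by (simp add: filterlim_at_top s_def)
  show ?thesis using ev1 ev2 ev3 eventually_ge_at_top[of 1]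
  proof eventually_elim
    case (elim n)
    have pn: "0 < p n" "p n < 1" using p elim by auto
    have n: "real n > 0" using elim by simp
    have L: "ln (1 / p n) > 0" using pn by simp
    have s: "s n > 0" using n pn by (simp add: s_def)
    have cs: "c * s n \<ge> 0" using c(1) s by simp
    have a_ge: "c * s n \<le> real (a n)" using cs unfolding a_def by linarith
    have a_le: "real (a n) \<le> c * s n + 1" using cs unfolding a_def by linarith
    have t_le: "t n \<le> (real n - real (a n) - real k) / real n"
    proof -
      have "t n * real n = real n - (c * s n + (real k + 1))" using n by (simp add: t_def s_def field_simps)
      also have "\<dots> \<le> real n - real (a n) - real k" using a_le by simp
      finally show ?thesis using n by (simp add: pos_le_divide_eq)
    qed
    have a_n: "a n + k \<le> n"
    proof -
      have "0 < (real n - real (a n) - real k) / real n" using t_le elim by simp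
      then have "real (a n) + real k < real n" using n by (simp add: zero_less_divide_iff)
      then show ?thesis by linarith
    qed
    have dens: "(1 + \<delta>) * p n ^ e \<le> hom_density k (clique_edges k) n (planted_hub (a n) (p n))"
    proof -
      define T where "T = (real n - real (a n) - real k) / real n"
      have "(1 + \<delta>) * p n ^ e \<le> (t n ^ k + real k * c * t n ^ N) * p n ^ e"
        using elim pn by (intro mult_right_mono) auto
      also have "\<dots> \<le> (T ^ k + real k * c * T ^ N) * p n ^ e"
        using elim pn t_le c unfolding T_def
        by (intro mult_right_mono add_mono mult_left_mono power_mono) auto
      also have "\<dots> = p n ^ e * T ^ k + real k * (c * s n / real n * p n ^ (e - N) * T ^ N)"
      proof -
        have "c * s n / real n * p n ^ (e - N) = c * p n ^ e"
          using n eN by (simp add: s_def mult.assoc power_add[symmetric])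
        then show ?thesis by (simp add: algebra_simps)
      qed
      also have "\<dots> \<le> p n ^ e * T ^ k + real k * (real (a n) / real n * p n ^ (e - N) * T ^ N)"
        using a_ge n pn t_le elim unfolding T_def
        by (intro add_left_mono mult_left_mono mult_right_mono divide_right_mono zero_le_power) auto
      also have "\<dots> \<le> hom_density k (clique_edges k) n (planted_hub (a n) (p n))"
        using planted_hub_density[OF pn, of n "a n" N] elim a_n unfolding T_def e_def k_def by simp
      finally show ?thesis .
    qed
    have "graph_entropy n (p n) (planted_hub (a n) (p n)) \<le> real (a n) * real n * ln (1 / p n)"
      by (rule planted_hub_entropy[OF pn])
    also have "\<dots> \<le> (\<delta> / real k + \<zeta>) * s n * real n * ln (1 / p n)"
    proof -
      have "1 \<le> \<zeta> / 2 * s n" using elim \<zeta> by (simp add: field_simps)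
      then have "real (a n) \<le> (\<delta> / real k + \<zeta>) * s n" using a_le by (simp add: c_def algebra_simps)
      then show ?thesis using L by (intro mult_right_mono) auto
    qed
    also have "\<dots> = (\<delta> / real k + \<zeta>) * (real n ^ 2 * p n ^ N * ln (1 / p n))"
      by (simp add: s_def power2_eq_square)
    finally show ?case
      using dens planted_hub_weighted[OF pn]
      by (intro bexI[of _ "planted_hub (a n) (p n)"]) (auto simp: admissible_def k_def e_def)
  qed
qed

text \<open>The lower bounds pass to the infimum, also over an empty set; the upper bounds exhibit
  admissible graphs, so the infimum is eventually finite.\<close>

lemma phi_ratio_tendsto:
  fixes Q :: "nat \<Rightarrow> real" and m :: real
  assumes Q: "eventually (\<lambda>n. Q n > 0) sequentially"
    and lower: "\<And>\<zeta>. \<zeta> > 0 \<Longrightarrow> eventually (\<lambda>n. \<forall>G\<in>admissible k n (p n) \<delta>.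
        (m - \<zeta>) * Q n \<le> graph_entropy n (p n) G) sequentially"
    and upper: "\<And>\<zeta>. \<zeta> > 0 \<Longrightarrow> eventually (\<lambda>n. \<exists>G\<in>admissible k n (p n) \<delta>.
        graph_entropy n (p n) G \<le> (m + \<zeta>) * Q n) sequentially"
  shows "(\<lambda>n. phi k (clique_edges k) n (p n) \<delta> / ereal (Q n)) \<longlonglongrightarrow> ereal m"
proof -
  have phi: "phi k (clique_edges k) n q \<delta> = (INF G\<in>admissible k n q \<delta>. ereal (graph_entropy n q G))" for n q
    by (simp add: phi_def admissible_def)
  show ?thesis
  proof (rule order_tendstoI)
    fix x assume "x < ereal m"
    \<comment> \<open>The infimum inherits only weak inequalities, so a real \<open>y\<close>
      strictly between is used.\<close>
    then obtain y where y: "x < ereal y" "ereal y < ereal m" using ereal_dense2 by blast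
    have "eventually (\<lambda>n. \<forall>G\<in>admissible k n (p n) \<delta>. y * Q n \<le> graph_entropy n (p n) G) sequentially"
      using lower[of "m - y"] y by simp
    then show "eventually (\<lambda>n. x < phi k (clique_edges k) n (p n) \<delta> / ereal (Q n)) sequentially"
      using Q
    proof eventually_elim
      case (elim n)
      then have *: "\<forall>G\<in>admissible k n (p n) \<delta>. y * Q n \<le> graph_entropy n (p n) G" and "0 < Q n" by auto
      have "ereal (Q n) * ereal y \<le> phi k (clique_edges k) n (p n) \<delta>"
        unfolding phi using * by (intro INF_greatest) (simp add: mult.commute)
      then have "ereal y \<le> phi k (clique_edges k) n (p n) \<delta> / ereal (Q n)"
        using \<open>0 < Q n\<close> by (subst ereal_le_divide_pos) auto
      then show ?case using y(1) by simp
    qed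
  next
    fix x assume "ereal m < x"
    then obtain y where y: "ereal m < ereal y" "ereal y < x" using ereal_dense2 by blast
    have "eventually (\<lambda>n. \<exists>G\<in>admissible k n (p n) \<delta>. graph_entropy n (p n) G \<le> y * Q n) sequentially"
      using upper[of "y - m"] y by simp
    then show "eventually (\<lambda>n. phi k (clique_edges k) n (p n) \<delta> / ereal (Q n) < x) sequentially"
      using Q
    proof eventually_elim
      case (elim n)
      then have *: "\<exists>G\<in>admissible k n (p n) \<delta>. graph_entropy n (p n) G \<le> y * Q n" and "0 < Q n" by auto
      have "phi k (clique_edges k) n (p n) \<delta> \<le> ereal (Q n) * ereal y"
        unfolding phi using * by (auto intro!: INF_lower2 simp: mult.commute)
      then have "phi k (clique_edges k) n (p n) \<delta> / ereal (Q n) \<le> ereal y"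
        using \<open>0 < Q n\<close> by (subst ereal_divide_le_pos) auto
      then show ?case using y(2) by simp
    qed
  qed
qed

theorem theorem4p1:
  fixes k :: nat and \<delta> :: real and p :: "nat \<Rightarrow> real"
  assumes "k \<ge> 3" and "\<delta> > 0"
    and "\<And>n. n \<ge> 1 \<Longrightarrow> 0 < p n \<and> p n < 1"
  shows "(filterlim (\<lambda>n. real n powr (1 / (real k - 1)) * p n) at_top sequentially
            \<and> p \<longlonglongrightarrow> 0 \<longrightarrow>
          (\<lambda>n. phi k (clique_edges k) n (p n) \<delta>
                 / ereal (real n ^ 2 * p n ^ (k - 1) * ln (1 / p n)))
            \<longlonglongrightarrow> ereal (min (1 / 2 * \<delta> powr (2 / real k)) (\<delta> / real k)))
       \<and> (filterlim (\<lambda>n. real n powr (2 / (real k - 1)) * p n) at_top sequentially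
            \<and> (\<lambda>n. real n powr (1 / (real k - 1)) * p n) \<longlonglongrightarrow> 0 \<longrightarrow>
          (\<lambda>n. phi k (clique_edges k) n (p n) \<delta>
                 / ereal (real n ^ 2 * p n ^ (k - 1) * ln (1 / p n)))
            \<longlonglongrightarrow> ereal (1 / 2 * \<delta> powr (2 / real k)))"
proof -
  define N where "N = k - 1"
  have k: "k = Suc N" and N: "N \<ge> 2" using assms(1) by (auto simp: N_def)
  have kN: "real k - 1 = real N" by (simp add: k)
  note p = assms(3)
  \<comment> \<open>Taking \<open>N\<close>-th powers turns the hypotheses into statements on
    \<open>real n * p n ^ N\<close>, the order of the hub size, and on
    \<open>real n ^ 2 * p n ^ N\<close>, the squared order of the clique size.\<close>
  have pow: "(real n powr (r / real N) * p n) ^ N = real n powr r * p n ^ N" if "n \<ge> 1" for n r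
    using that N by (simp add: power_mult_distrib powr_realpow[symmetric] powr_powr)
  have Qpos: "eventually (\<lambda>n. real n ^ 2 * p n ^ N * ln (1 / p n) > 0) sequentially"
    using eventually_ge_at_top[of 1] by eventually_elim (use p in auto)
  have right: "filterlim p (at_right 0) sequentially" if "p \<longlonglongrightarrow> 0"
  proof (rule tendsto_imp_filterlim_at_right[OF that])
    show "eventually (\<lambda>n. p n > 0) sequentially"
      using eventually_ge_at_top[of 1] by eventually_elim (use p in auto)
  qed
  have pow_top: "filterlim (\<lambda>n. real n powr r * p n ^ N) at_top sequentially"
    if "filterlim (\<lambda>n. real n powr (r / real N) * p n) at_top sequentially" for r
  proof -
    have "filterlim (\<lambda>n. (real n powr (r / real N) * p n) ^ N) at_top sequentially"
      using N by (intro filterlim_pow_at_top that) auto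
    moreover have "eventually (\<lambda>n. (real n powr (r / real N) * p n) ^ N = real n powr r * p n ^ N) sequentially"
      using eventually_ge_at_top[of 1] by eventually_elim (rule pow)
    ultimately show ?thesis by (rule filterlim_mono_eventually[OF _ order_refl order_refl])
  qed
  have first: "(\<lambda>n. phi k (clique_edges k) n (p n) \<delta> / ereal (real n ^ 2 * p n ^ N * ln (1 / p n)))
      \<longlonglongrightarrow> ereal (min (1 / 2 * \<delta> powr (2 / real k)) (\<delta> / real k))"
    if top: "filterlim (\<lambda>n. real n powr (1 / real N) * p n) at_top sequentially" and p0: "p \<longlonglongrightarrow> 0"
  proof (rule phi_ratio_tendsto[OF Qpos])
    have big1: "filterlim (\<lambda>n. real n * p n ^ N) at_top sequentially"
      using pow_top[of 1] top by simp
    have big2: "filterlim (\<lambda>n. real n ^ 2 * p n ^ N) at_top sequentially"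
    proof (rule filterlim_at_top_mono[OF big1])
      show "eventually (\<lambda>n. real n * p n ^ N \<le> real n ^ 2 * p n ^ N) sequentially"
        using eventually_ge_at_top[of 1]
      proof eventually_elim
        case (elim n)
        then show ?case using p[of n] self_le_power[of "real n" 2] by (intro mult_right_mono) auto
      qed
    qed
    fix \<zeta> :: real assume \<zeta>: "\<zeta> > 0"
    show "eventually (\<lambda>n. \<forall>G\<in>admissible k n (p n) \<delta>.
        (min (1 / 2 * \<delta> powr (2 / real k)) (\<delta> / real k) - \<zeta>) * (real n ^ 2 * p n ^ N * ln (1 / p n))
          \<le> graph_entropy n (p n) G) sequentially"
      unfolding k by (rule entropy_lower_bound[OF N assms(2) \<zeta> right[OF p0]]) simp
    show "eventually (\<lambda>n. \<exists>G\<in>admissible k n (p n) \<delta>. graph_entropy n (p n) G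
        \<le> (min (1 / 2 * \<delta> powr (2 / real k)) (\<delta> / real k) + \<zeta>) * (real n ^ 2 * p n ^ N * ln (1 / p n))) sequentially"
    \<comment> \<open>The cheaper of the two planted graphs attains the minimum.\<close>
    proof (cases "1 / 2 * \<delta> powr (2 / real k) \<le> \<delta> / real k")
      case True
      then have "min (1 / 2 * \<delta> powr (2 / real k)) (\<delta> / real k) = 1 / 2 * \<delta> powr (2 / real k)" by simp
      then show ?thesis
        using clique_upper_bound[OF N assms(2) \<zeta> p p0 big2] unfolding k by (simp only:)
    next
      case False
      then have "min (1 / 2 * \<delta> powr (2 / real k)) (\<delta> / real k) = \<delta> / real k" by simp
      then show ?thesis
        using hub_upper_bound[OF N assms(2) \<zeta> p p0 big1] unfolding k by (simp only:)
    qed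
  qed
  have second: "(\<lambda>n. phi k (clique_edges k) n (p n) \<delta> / ereal (real n ^ 2 * p n ^ N * ln (1 / p n)))
      \<longlonglongrightarrow> ereal (1 / 2 * \<delta> powr (2 / real k))"
    if top: "filterlim (\<lambda>n. real n powr (2 / real N) * p n) at_top sequentially"
      and zero: "(\<lambda>n. real n powr (1 / real N) * p n) \<longlonglongrightarrow> 0"
  proof (rule phi_ratio_tendsto[OF Qpos])
    \<comment> \<open>Here \<open>p\<close> tends to 0 because it is at most
      \<open>real n powr (1 / real N) * p n\<close>.\<close>
    have p0: "p \<longlonglongrightarrow> 0"
    proof (rule tendsto_sandwich[OF _ _ tendsto_const zero])
      show "eventually (\<lambda>n. 0 \<le> p n) sequentially"
        using eventually_ge_at_top[of 1] by eventually_elim (use p in \<open>auto simp: less_imp_le\<close>)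
      show "eventually (\<lambda>n. p n \<le> real n powr (1 / real N) * p n) sequentially"
        using eventually_ge_at_top[of 1]
      proof eventually_elim
        case (elim n)
        then have "1 * p n \<le> real n powr (1 / real N) * p n"
          using p[of n] N by (intro mult_right_mono ge_one_powr_ge_zero) auto
        then show ?case by simp
      qed
    qed
    have small: "(\<lambda>n. real n * p n ^ N) \<longlonglongrightarrow> 0"
    proof -
      have "(\<lambda>n. (real n powr (1 / real N) * p n) ^ N) \<longlonglongrightarrow> 0 ^ N" by (intro tendsto_intros zero)
      moreover have "eventually (\<lambda>n. (real n powr (1 / real N) * p n) ^ N = real n * p n ^ N) sequentially"
        using eventually_ge_at_top[of 1] by eventually_elim (use pow[of _ 1] in simp)
      ultimately show ?thesis using N by (simp add: power_0_left tendsto_cong)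
    qed
    have big2: "filterlim (\<lambda>n. real n ^ 2 * p n ^ N) at_top sequentially"
      using pow_top[OF top] by simp
    fix \<zeta> :: real assume \<zeta>: "\<zeta> > 0"
    show "eventually (\<lambda>n. \<forall>G\<in>admissible k n (p n) \<delta>.
        (1 / 2 * \<delta> powr (2 / real k) - \<zeta>) * (real n ^ 2 * p n ^ N * ln (1 / p n))
          \<le> graph_entropy n (p n) G) sequentially"
      unfolding k by (rule entropy_lower_bound[OF N assms(2) \<zeta> right[OF p0]]) (use small in simp)
    show "eventually (\<lambda>n. \<exists>G\<in>admissible k n (p n) \<delta>. graph_entropy n (p n) G
        \<le> (1 / 2 * \<delta> powr (2 / real k) + \<zeta>) * (real n ^ 2 * p n ^ N * ln (1 / p n))) sequentially"
      using clique_upper_bound[OF N assms(2) \<zeta> p p0 big2] unfolding k .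
  qed
  show ?thesis unfolding kN N_def[symmetric] using first second by blast
qed

end
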